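(* Let $N\ge2$, $0<R_i<R_e$, and $\mathfrak{A}=\{x\in\mathbb{R}^N:R_i<|x|<R_e\}$. Let $A\colon\,]0,+\infty[\,\to\,]0,+\infty[$ be continuous and such that $\phi(\xi)=A(|\xi|)\xi$ for $\xi\ne0$, $\phi(0)=0$, defines a homeomorphism of $\mathbb{R}$; let $G\colon[R_i,R_e]\times\mathbb{R}\to\mathbb{R}$ be continuous. For $s\in\mathbb{R}$ consider the Neumann problem $$\nabla\cdot(A(|\nabla u|)\nabla u)+G(|x|,u)=s\ \text{in }\mathfrak{A},\qquad \frac{\partial u}{\partial\nu}=0\ \text{on }\partial\mathfrak{A}.\qquad(P_s)$$ Assume: $(G_1)$ there is $C_0>0$ with $G(|x|,u)\ge-C_0$ for all $u\in\mathbb{R}$, $x\in\mathfrak{A}$; $(G_2)$ there are $u_0,g_0\in\mathbb{R}$ with $G(|x|,u_0)\le g_0$ for all $x\in\mathfrak{A}$; $(G_3)$ for each $\sigma\in\mathbb{R}$ there is $d_\sigma>0$ such that $\frac1{|\mathfrak{A}|}\int_{\mathfrak{A}}G(|x|,u(x))\,dx>\sigma$ for every radially symmetric $u\in\mathcal{C}^0(\overline{\mathfrak{A}})\cap\mathcal{C}^1(\mathfrak{A})$ with $u(x)\le-d_\sigma$ for all $x\in\mathfrak{A}$; $(G_4)$ for each $\sigma\in\mathbb{R}$ there is $d_\sigma>0$ such that $\frac1{|\mathfrak{A}|}\int_{\mathfrak{A}}G(|x|,u(x))\,dx>\sigma$ for every radially symmetric $u\in\mathcal{C}^0(\overline{\mathfrak{A}})\cap\mathcal{C}^1(\mathfrak{A})$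 with $u(x)\ge d_\sigma$ for all $x\in\mathfrak{A}$. Then there exists $s_0\in\mathbb{R}$ such that: for $s<s_0$, $(P_s)$ has no radially symmetric solutions; for $s=s_0$, at least one; for $s>s_0$, at least two radially symmetric solutions.
   Context: Solutions are classical solutions; a radially symmetric solution is one of the form $u(x)=v(|x|)$. $|\mathfrak{A}|$ denotes the Lebesgue measure of $\mathfrak{A}$ and $\nu$ the outer unit normal. *)

theory Defs
  imports "HOL-Analysis.Analysis"
begin

definition annulus :: "real \<Rightarrow> real \<Rightarrow> (real^'n) set" where
  "annulus Rint Rext = {x. Rint < norm x \<and> norm x < Rext}"

definition closed_annulus :: "real \<Rightarrow> real \<Rightarrow> (real^'n) set" where
  "closed_annulus Rint Rext = {x. Rint \<le> norm x \<and> norm x \<le> Rext}"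

definition outer_normal :: "real \<Rightarrow> (real^'n) \<Rightarrow> real^'n" where
  "outer_normal Rext x = (if norm x = Rext then (1 / norm x) *\<^sub>R x else - ((1 / norm x) *\<^sub>R x))"

definition C1_on :: "(real^'n) set \<Rightarrow> (real^'n \<Rightarrow> real) \<Rightarrow> bool" where
  "C1_on S u \<longleftrightarrow> (\<exists>Du. continuous_on S Du \<and>
      (\<forall>x\<in>S. (u has_derivative (\<lambda>h. Du x \<bullet> h)) (at x within S)))"

definition C1_field_on :: "(real^'n) set \<Rightarrow> (real^'n \<Rightarrow> real^'n) \<Rightarrow> bool" where
  "C1_field_on S w \<longleftrightarrow> (\<forall>x\<in>S. w differentiable (at x)) \<and>
      (\<forall>v. continuous_on S (\<lambda>x. frechet_derivative w (at x) v))"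

definition divergence :: "(real^'n \<Rightarrow> real^'n) \<Rightarrow> real^'n \<Rightarrow> real" where
  "divergence w x = (\<Sum>i\<in>UNIV. (frechet_derivative w (at x) (axis i 1)) $ i)"

definition phiN :: "(real \<Rightarrow> real) \<Rightarrow> real^'n \<Rightarrow> real^'n" where
  "phiN A \<xi> = (if \<xi> = 0 then 0 else A (norm \<xi>) *\<^sub>R \<xi>)"

definition phi1 :: "(real \<Rightarrow> real) \<Rightarrow> real \<Rightarrow> real" where
  "phi1 A \<xi> = (if \<xi> = 0 then 0 else A \<bar>\<xi>\<bar> * \<xi>)"

definition radial_on :: "(real^'n) set \<Rightarrow> (real^'n \<Rightarrow> real) \<Rightarrow> bool" where
  "radial_on S u \<longleftrightarrow> (\<exists>v. \<forall>x\<in>S. u x = v (norm x))"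

definition is_solution ::
  "(real \<Rightarrow> real) \<Rightarrow> (real \<Rightarrow> real \<Rightarrow> real) \<Rightarrow> real \<Rightarrow> real \<Rightarrow> real \<Rightarrow> (real^'n \<Rightarrow> real) \<Rightarrow> bool" where
  "is_solution A G Rint Rext s u \<longleftrightarrow>
     (\<exists>Du. continuous_on (closed_annulus Rint Rext) Du \<and>
        (\<forall>x\<in>closed_annulus Rint Rext. (u has_derivative (\<lambda>h. Du x \<bullet> h)) (at x within closed_annulus Rint Rext)) \<and>
        C1_field_on (annulus Rint Rext) (\<lambda>x. phiN A (Du x)) \<and>
        (\<forall>x\<in>annulus Rint Rext. divergence (\<lambda>y. phiN A (Du y)) x + G (norm x) (u x) = s) \<and>
        (\<forall>x. norm x = Rint \<or> norm x = Rext \<longrightarrow> Du x \<bullet> outer_normal Rext x = 0))"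

definition radial_solution ::
  "(real \<Rightarrow> real) \<Rightarrow> (real \<Rightarrow> real \<Rightarrow> real) \<Rightarrow> real \<Rightarrow> real \<Rightarrow> real \<Rightarrow> (real^'n \<Rightarrow> real) \<Rightarrow> bool" where
  "radial_solution A G Rint Rext s u \<longleftrightarrow> is_solution A G Rint Rext s u \<and> radial_on (closed_annulus Rint Rext) u"

definition avgG :: "(real \<Rightarrow> real \<Rightarrow> real) \<Rightarrow> real \<Rightarrow> real \<Rightarrow> (real^'n \<Rightarrow> real) \<Rightarrow> real" where
  "avgG G Rint Rext u = integral (annulus Rint Rext) (\<lambda>x. G (norm x) (u x)) / measure lebesgue (annulus Rint Rext :: (real^'n) set)"

end

theory Submission
  imports Defs "HOL-Complex_Analysis.Great_Picard"
begin

text \<open>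
  For radial functions the problem is the system \<open>v' = \<psi> (w / r\<^bsup>N-1\<^esup>)\<close>, \<open>w' = r\<^bsup>N-1\<^esup> (s - G(r, v))\<close>
  with \<open>w = 0\<close> at both radii, where \<open>\<psi>\<close> is the inverse of \<open>\<phi>\<close>. Instead of degree theory, shoot from
  \<open>v = c\<close>, \<open>w = 0\<close> at the inner radius. Since \<open>G\<close> is bounded below, the flux \<open>w\<close> of every solution is bounded
  a priori, so \<open>w\<close> may be truncated inside \<open>\<psi>\<close>; then \<open>v\<close> has bounded oscillation and the coercivity
  conditions make the final flux negative for \<open>|c|\<close> large. A trajectory that stays below a strict upper
  solution \<open>\<beta>\<close> and touches it has positive final flux. Hence the final flux vanishes for some \<open>c\<close> before the
  first trajectory touching \<open>\<beta>\<close>, and for some \<open>c\<close> after the last one, and these are two different solutions.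
  A solution at level \<open>s\<^sub>1\<close> is a strict upper solution at every level \<open>s > s\<^sub>1\<close>, so the solvable
  levels form an up-closed set, which is closed by compactness.

  As \<open>G\<close> and \<open>\<psi>\<close> are only continuous, trajectories need not be unique; the argument is carried out for the
  equation with a small delay, whose trajectories depend continuously on \<open>c\<close>, and the delay then tends to zero.
\<close>

section \<open>Delay equations\<close>

text \<open>Substituting \<open>a + \<theta> * (t - a)\<close> moves the variable upper limit into
  the integrand, and over the fixed interval from 0 to 1 the theorem on integrals with a parameter
  applies. This makes the iterates below jointly continuous in initial value and time.\<close>

lemma continuous_on_integral_upper_limit:
  fixes g :: "'a::topological_space \<Rightarrow> real \<Rightarrow> 'b::euclidean_space"
  assumes g: "continuous_on (S \<times> {a..b}) (\<lambda>(c, t). g c t)"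
  shows "continuous_on (S \<times> {a..b}) (\<lambda>(c, t). integral {a..t} (g c))"
proof -
  have resc: "integral {a..t} (g c) = integral {0..1} (\<lambda>\<theta>. (t - a) *\<^sub>R g c (a + \<theta> * (t - a)))"
    if c: "c \<in> S" and t: "t \<in> {a..b}" for c t
  proof -
    have gc: "continuous_on {a..b} (g c)"
      using continuous_on_compose2[OF g continuous_on_Pair[OF continuous_on_const continuous_on_id], of c "{a..b}"] c
      by auto
    have "((\<lambda>\<theta>. (t - a) *\<^sub>R g c (a + \<theta> * (t - a))) has_integral
        (integral {a..a + 1 * (t - a)} (g c) - integral {a..a + 0 * (t - a)} (g c))) {0..1}"
    proof (rule fundamental_theorem_of_calculus)
      fix \<theta> :: real assume th: "\<theta> \<in> {0..1}"
      have im: "(\<lambda>\<theta>. a + \<theta> * (t - a)) ` {0..1} \<subseteq> {a..b}"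
      proof safe
        fix x :: real assume "x \<in> {0..1}"
        then have "0 \<le> x * (t - a)" "x * (t - a) \<le> 1 * (t - a)"
          using t by (auto intro: mult_left_le_one_le)
        then show "a + x * (t - a) \<in> {a..b}" using t by auto
      qed
      have "((\<lambda>u. integral {a..u} (g c)) has_vector_derivative g c (a + \<theta> * (t - a)))
          (at (a + \<theta> * (t - a)) within {a..b})"
        using im th by (intro integral_has_vector_derivative gc) blast
      then have "((\<lambda>u. integral {a..u} (g c)) has_vector_derivative g c (a + \<theta> * (t - a)))
          (at (a + \<theta> * (t - a)) within (\<lambda>\<theta>. a + \<theta> * (t - a)) ` {0..1})"
        using im by (rule has_vector_derivative_within_subset)
      moreover have "((\<lambda>\<theta>. a + \<theta> * (t - a)) has_vector_derivative (t - a)) (at \<theta> within {0..1})"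
        by (auto intro!: derivative_eq_intros simp: has_real_derivative_iff_has_vector_derivative[symmetric])
      ultimately show "((\<lambda>\<theta>. integral {a..a + \<theta> * (t - a)} (g c)) has_vector_derivative
          (t - a) *\<^sub>R g c (a + \<theta> * (t - a))) (at \<theta> within {0..1})"
        using vector_diff_chain_within[of "\<lambda>\<theta>. a + \<theta> * (t - a)" "t - a" \<theta> "{0..1}" "\<lambda>u. integral {a..u} (g c)"]
        by (simp add: o_def)
    qed simp
    from integral_unique[OF this] show ?thesis by simp
  qed
  have "continuous_on (S \<times> {a..b})
      (\<lambda>p. integral (cbox 0 1) (\<lambda>\<theta>. (snd p - a) *\<^sub>R g (fst p) (a + \<theta> * (snd p - a))))"
  proof (rule integral_continuous_on_param)
    have "continuous_on ((S \<times> {a..b}) \<times> cbox 0 1)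
       (\<lambda>q. (\<lambda>(c, t). g c t) (fst (fst q), a + snd q * (snd (fst q) - a)))"
    proof (rule continuous_on_compose2[OF g])
      show "continuous_on ((S \<times> {a..b}) \<times> cbox 0 1) (\<lambda>q. (fst (fst q), a + snd q * (snd (fst q) - a)))"
        by (intro continuous_intros)
      show "(\<lambda>q. (fst (fst q), a + snd q * (snd (fst q) - a))) ` ((S \<times> {a..b}) \<times> cbox 0 1) \<subseteq> S \<times> {a..b}"
      proof safe
        fix c t and x :: real assume x: "x \<in> cbox 0 1" and t: "t \<in> {a..b}"
        then have "0 \<le> x * (t - a)" "x * (t - a) \<le> 1 * (t - a)"
          by (auto intro: mult_left_le_one_le)
        then show "a + snd ((c, t), x) * (snd (fst ((c, t), x)) - a) \<in> {a..b}"
          using t by auto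
      qed simp
    qed
    then show "continuous_on ((S \<times> {a..b}) \<times> cbox 0 1)
       (\<lambda>(p, \<theta>). (snd p - a) *\<^sub>R g (fst p) (a + \<theta> * (snd p - a)))"
      unfolding case_prod_beta by (intro continuous_intros) (simp add: case_prod_beta)
  qed
  then show ?thesis
    by (rule continuous_on_eq) (auto simp: resc)
qed

text \<open>Method of steps: the right-hand side at time \<open>t\<close> reads the solution only at
  \<open>max a (t - \<delta>)\<close>, so Picard iteration is exact on intervals that grow by
  \<open>\<delta>\<close> and reaches a solution after finitely many rounds. No limit is taken, and
  each iterate is continuous in \<open>c\<close>.\<close>

lemma delay_equation_solution:
  fixes f :: "real \<Rightarrow> 'a::euclidean_space \<Rightarrow> 'a"
  assumes ab: "a \<le> b" and f: "continuous_on ({a..b} \<times> UNIV) (\<lambda>(t, x). f t x)" and d: "\<delta> > 0"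
  obtains X :: "'a \<Rightarrow> real \<Rightarrow> 'a" where
    "continuous_on (UNIV \<times> {a..b}) (\<lambda>(c, t). X c t)"
    "\<And>c. X c a = c"
    "\<And>c t. t \<in> {a..b} \<Longrightarrow> (X c has_vector_derivative f t (X c (max a (t - \<delta>)))) (at t within {a..b})"
proof -
  define T where "T = (\<lambda>Y (c::'a) t. c + integral {a..t} (\<lambda>\<tau>. f \<tau> (Y c (max a (\<tau> - \<delta>)))))"
  define X where "X = (\<lambda>n. (T ^^ n) (\<lambda>c t. c))"
  have X0: "X 0 = (\<lambda>c t. c)" and XS: "X (Suc n) = T (X n)" for n
    by (simp_all add: X_def)
  have rhs: "continuous_on (UNIV \<times> {a..b}) (\<lambda>(c, \<tau>). f \<tau> (Y c (max a (\<tau> - \<delta>))))"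
    if Y: "continuous_on (UNIV \<times> {a..b}) (\<lambda>(c, t). Y c t)" for Y :: "'a \<Rightarrow> real \<Rightarrow> 'a"
  proof -
    have "continuous_on (UNIV \<times> {a..b}) (\<lambda>p. (\<lambda>(c, t). Y c t) (fst p, max a (snd p - \<delta>)))"
      using d by (intro continuous_on_compose2[OF Y]) (auto intro!: continuous_intros)
    then have "continuous_on (UNIV \<times> {a..b}) (\<lambda>p. (\<lambda>(t, x). f t x) (snd p, Y (fst p) (max a (snd p - \<delta>))))"
      by (intro continuous_on_compose2[OF f]) (auto intro!: continuous_intros)
    then show ?thesis by (simp add: case_prod_beta)
  qed
  have cont: "continuous_on (UNIV \<times> {a..b}) (\<lambda>(c, t). X n c t)" for n
  proof (induction n)
    case 0 then show ?case by (auto simp: X0 case_prod_beta intro!: continuous_intros)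
  next
    case (Suc n)
    have "continuous_on (UNIV \<times> {a..b}) (\<lambda>(c, t). integral {a..t} (\<lambda>\<tau>. f \<tau> (X n c (max a (\<tau> - \<delta>)))))"
      by (rule continuous_on_integral_upper_limit) (rule rhs[OF Suc])
    then show ?case
      unfolding XS T_def case_prod_beta by (auto intro!: continuous_intros)
  qed
  \<comment> \<open>For times up to \<open>a + Suc n * \<delta>\<close> the delayed argument falls
    back into the range up to \<open>a + n * \<delta>\<close>, where the iterates already
    agree.\<close>
  have stable: "X (Suc n) c t = X n c t" if "t \<in> {a..b}" "t \<le> a + n * \<delta>" for n c t
    using that
  proof (induction n arbitrary: t)
    case 0
    then have "t = a" by simp
    then show ?case by (simp add: XS X0 T_def)
  next
    case (Suc n)
    have "integral {a..t} (\<lambda>\<tau>. f \<tau> (X (Suc n) c (max a (\<tau> - \<delta>)))) =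
          integral {a..t} (\<lambda>\<tau>. f \<tau> (X n c (max a (\<tau> - \<delta>))))"
    proof (rule integral_cong)
      fix \<tau> assume "\<tau> \<in> {a..t}"
      then have "X (Suc n) c (max a (\<tau> - \<delta>)) = X n c (max a (\<tau> - \<delta>))"
        using Suc.prems d ab by (intro Suc.IH) (auto simp: algebra_simps)
      then show "f \<tau> (X (Suc n) c (max a (\<tau> - \<delta>))) = f \<tau> (X n c (max a (\<tau> - \<delta>)))" by simp
    qed
    then show ?case by (subst XS, subst (2) XS) (simp only: T_def)
  qed
  \<comment> \<open>For this \<open>n\<close> the range of agreement covers \<open>{a..b}\<close>,
    so the iterate is a fixed point of \<open>T\<close> there.\<close>
  obtain n where n: "b - a < real n * \<delta>"
    using reals_Archimedean3[OF d] by blast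
  have fix_eq: "X n c t = c + integral {a..t} (\<lambda>\<tau>. f \<tau> (X n c (max a (\<tau> - \<delta>))))" if "t \<in> {a..b}" for c t
    using stable[of t n c] n that by (simp add: XS T_def)
  show ?thesis
  proof
    show "continuous_on (UNIV \<times> {a..b}) (\<lambda>(c, t). X n c t)" by (rule cont)
    show "X n c a = c" for c using fix_eq[of a c] ab by simp
    fix c t assume t: "t \<in> {a..b}"
    have "continuous_on {a..b} (\<lambda>\<tau>. f \<tau> (X n c (max a (\<tau> - \<delta>))))"
      using continuous_on_compose2[OF rhs[OF cont[of n]] continuous_on_Pair[OF continuous_on_const continuous_on_id],
        of c "{a..b}"]
      by auto
    from integral_has_vector_derivative[OF this t]
    have "((\<lambda>t. c + integral {a..t} (\<lambda>\<tau>. f \<tau> (X n c (max a (\<tau> - \<delta>))))) has_vector_derivative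
        f t (X n c (max a (t - \<delta>)))) (at t within {a..b})"
      by (auto intro!: derivative_eq_intros)
    then show "(X n c has_vector_derivative f t (X n c (max a (t - \<delta>)))) (at t within {a..b})"
      using t by (rule has_vector_derivative_transform[rotated 2]) (rule fix_eq)
  qed
qed

lemma norm_vector_derivative_bound:
  fixes x :: "real \<Rightarrow> 'a::real_normed_vector"
  assumes "\<And>t. t \<in> {a..b} \<Longrightarrow> (x has_vector_derivative x' t) (at t within {a..b})"
    and "\<And>t. t \<in> {a..b} \<Longrightarrow> norm (x' t) \<le> B" and "s \<in> {a..b}" "t \<in> {a..b}"
  shows "norm (x s - x t) \<le> B * \<bar>s - t\<bar>"
proof -
  have "norm (x s - x t) \<le> B * norm (s - t)"
  proof (rule differentiable_bound[of "{a..b}" x "\<lambda>t h. h *\<^sub>R x' t" B s t])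
    fix t assume "t \<in> {a..b}"
    then show "onorm (\<lambda>h. h *\<^sub>R x' t) \<le> B"
      using assms(2) by (simp add: onorm_scaleR_left onorm_id)
  qed (use assms in \<open>auto simp: has_vector_derivative_def\<close>)
  then show ?thesis by simp
qed

text \<open>Bounded trajectories have bounded derivatives, hence a common Lipschitz constant, and
  Arzela-Ascoli yields a uniformly convergent subsequence. Zero delay is allowed, so the lemma
  serves both for removing the delay and for the compactness of undelayed solutions at varying
  \<open>s\<close>.\<close>

lemma delay_equation_limit:
  fixes f :: "real \<Rightarrow> real \<Rightarrow> 'a::euclidean_space \<Rightarrow> 'a"
  assumes f: "continuous_on (UNIV \<times> {a..b} \<times> UNIV) (\<lambda>(s, t, x). f s t x)"
    and s: "s \<longlonglongrightarrow> s0" and d: "\<delta> \<longlonglongrightarrow> 0" "\<And>k. 0 \<le> \<delta> k"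
    and deriv: "\<And>k t. t \<in> {a..b} \<Longrightarrow>
      (x k has_vector_derivative f (s k) t (x k (max a (t - \<delta> k)))) (at t within {a..b})"
    and bound: "\<And>k t. t \<in> {a..b} \<Longrightarrow> norm (x k t) \<le> R"
  obtains r y where "strict_mono (r :: nat \<Rightarrow> nat)"
    "uniform_limit {a..b} (\<lambda>k. x (r k)) y sequentially"
    "\<And>t. t \<in> {a..b} \<Longrightarrow> (y has_vector_derivative f s0 t (y t)) (at t within {a..b})"
proof -
  obtain S where S: "\<And>k. \<bar>s k\<bar> \<le> S"
    using s by (metis Bseq_def convergentI convergent_imp_Bseq real_norm_def)
  have "compact ({-S..S} \<times> {a..b} \<times> cball 0 R :: (real \<times> real \<times> 'a) set)"
    by (intro compact_Times compact_cball compact_Icc)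
  then have "compact ((\<lambda>(s, t, x). f s t x) ` ({-S..S} \<times> {a..b} \<times> cball 0 R))"
    by (intro compact_continuous_image continuous_on_subset[OF f]) auto
  then obtain B where B: "\<And>s t x. \<lbrakk>\<bar>s\<bar> \<le> S; t \<in> {a..b}; norm x \<le> R\<rbrakk> \<Longrightarrow> norm (f s t x) \<le> B"
    by (auto simp: abs_le_iff dest!: compact_imp_bounded simp: bounded_iff) (force simp: abs_le_iff)
  have lag: "max a (t - \<delta> k) \<in> {a..b}" if "t \<in> {a..b}" for t k
    using that d(2)[of k] by auto
  have fB: "norm (f (s k) t (x k (max a (t - \<delta> k)))) \<le> B" if "t \<in> {a..b}" for k t
    by (intro B S bound lag that)
  have lip: "norm (x k t - x k t') \<le> B * \<bar>t - t'\<bar>" if "t \<in> {a..b}" "t' \<in> {a..b}" for k t t'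
    using deriv fB that by (rule norm_vector_derivative_bound)
  have "\<exists>d>0. \<forall>n t'. t' \<in> {a..b} \<and> norm (t - t') < d \<longrightarrow> norm (x n t - x n t') < e"
    if t: "t \<in> {a..b}" and e: "0 < e" for t e
  proof (intro exI conjI allI impI)
    \<comment> \<open>The sign of \<open>B\<close> is not known here.\<close>
    show "0 < e / (\<bar>B\<bar> + 1)" using e by simp
    fix n t' assume "t' \<in> {a..b} \<and> norm (t - t') < e / (\<bar>B\<bar> + 1)"
    then have t': "t' \<in> {a..b}" "\<bar>t - t'\<bar> * (\<bar>B\<bar> + 1) < e" by (auto simp: field_simps)
    have "norm (x n t - x n t') \<le> B * \<bar>t - t'\<bar>" by (rule lip[OF t t'(1)])
    also have "\<dots> \<le> (\<bar>B\<bar> + 1) * \<bar>t - t'\<bar>" by (intro mult_right_mono) auto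
    also have "\<dots> < e" using t' by (simp add: mult.commute)
    finally show "norm (x n t - x n t') < e" .
  qed
  then obtain y r where y: "continuous_on {a..b} y" and r: "strict_mono (r :: nat \<Rightarrow> nat)"
    and conv: "\<And>e. 0 < e \<Longrightarrow> \<exists>N. \<forall>n t. n \<ge> N \<and> t \<in> {a..b} \<longrightarrow> norm (x (r n) t - y t) < e"
    using Arzela_Ascoli[OF compact_Icc[of a b], of x R] bound by metis
  have ul: "uniform_limit {a..b} (\<lambda>k. x (r k)) y sequentially"
    unfolding uniform_limit_sequentially_iff dist_norm using conv by blast
  have lim_y: "(\<lambda>k. x (r k) t) \<longlonglongrightarrow> y t" if "t \<in> {a..b}" for t
    using tendsto_uniform_limitI[OF ul that] .
  \<comment> \<open>The common Lipschitz constant turns the vanishing lag into a vanishing change of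
    \<open>x\<close>.\<close>
  have lim_lag: "(\<lambda>k. x (r k) (max a (t - \<delta> (r k)))) \<longlonglongrightarrow> y t" if t: "t \<in> {a..b}" for t
  proof -
    have "(\<lambda>k. B * \<bar>max a (t - \<delta> (r k)) - t\<bar>) \<longlonglongrightarrow> B * \<bar>max a (t - 0) - t\<bar>"
      using LIMSEQ_subseq_LIMSEQ[OF d(1) r] by (intro tendsto_intros) (auto simp: o_def)
    then have "(\<lambda>k. B * \<bar>max a (t - \<delta> (r k)) - t\<bar>) \<longlonglongrightarrow> 0"
      using t by simp
    then have "(\<lambda>k. x (r k) (max a (t - \<delta> (r k))) - x (r k) t) \<longlonglongrightarrow> 0"
      by (rule Lim_null_comparison[rotated]) (use lip lag t in auto)
    from tendsto_add[OF this lim_y[OF t]] show ?thesis by simp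
  qed
  have lim_f: "(\<lambda>k. f (s (r k)) t (x (r k) (max a (t - \<delta> (r k))))) \<longlonglongrightarrow> f s0 t (y t)"
    if t: "t \<in> {a..b}" for t
  proof -
    have "(\<lambda>k. (s (r k), t, x (r k) (max a (t - \<delta> (r k))))) \<longlonglongrightarrow> (s0, t, y t)"
      using LIMSEQ_subseq_LIMSEQ[OF s r] lim_lag[OF t] by (intro tendsto_intros) (auto simp: o_def)
    from continuous_on_tendsto_compose[OF f this] t show ?thesis by simp
  qed
  have int: "((\<lambda>\<tau>. f (s k) \<tau> (x k (max a (\<tau> - \<delta> k)))) has_integral (x k t - x k a)) {a..t}"
    if t: "t \<in> {a..b}" for k t
    using t by (intro fundamental_theorem_of_calculus has_vector_derivative_within_subset[OF deriv]) auto
  \<comment> \<open>The limit is taken in the integral equation, by dominated convergence;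
    continuity of the limiting integrand then gives back the differential equation.\<close>
  have int_y: "((\<lambda>\<tau>. f s0 \<tau> (y \<tau>)) has_integral (y t - y a)) {a..t}" if t: "t \<in> {a..b}" for t
  proof (rule has_integral_dominated_convergence[where h = "\<lambda>_. B"])
    show "((\<lambda>\<tau>. f (s (r k)) \<tau> (x (r k) (max a (\<tau> - \<delta> (r k))))) has_integral
        (x (r k) t - x (r k) a)) {a..t}" for k
      by (rule int[OF t])
    show "(\<lambda>k. x (r k) t - x (r k) a) \<longlonglongrightarrow> y t - y a"
      using t by (intro tendsto_diff lim_y) auto
  qed (use fB lim_f t in auto)
  have "continuous_on {a..b} (\<lambda>t. (\<lambda>(s, t, x). f s t x) (s0, t, y t))"
    using y by (intro continuous_on_compose2[OF f]) (auto intro!: continuous_intros)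
  then have fy: "continuous_on {a..b} (\<lambda>t. f s0 t (y t))" by simp
  show ?thesis
  proof
    fix t assume t: "t \<in> {a..b}"
    have "((\<lambda>t. y a + integral {a..t} (\<lambda>\<tau>. f s0 \<tau> (y \<tau>))) has_vector_derivative f s0 t (y t)) (at t within {a..b})"
      using integral_has_vector_derivative[OF fy t] by (auto intro!: derivative_eq_intros)
    then show "(y has_vector_derivative f s0 t (y t)) (at t within {a..b})"
      using t by (rule has_vector_derivative_transform[rotated 2]) (simp add: integral_unique[OF int_y])
  qed (use r ul in auto)
qed

section \<open>The radial boundary value problem\<close>

lemma has_real_derivative_Icc_at:
  fixes f :: "real \<Rightarrow> real"
  assumes "(f has_real_derivative D) (at x within {a..b})" "a < x" "x < b"
  shows "(f has_real_derivative D) (at x)"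
  using assms by (simp add: at_within_Icc_at)

text \<open>A one-sided mean value inequality, suited to the flux: \<open>G\<close> is bounded below
  uniformly in \<open>u\<close>, which bounds the derivative of the flux from above only.\<close>

lemma diff_le_of_derivative_le:
  fixes w :: "real \<Rightarrow> real"
  assumes w: "\<And>x. x \<in> {a..b} \<Longrightarrow> (w has_real_derivative w' x) (at x within {a..b})"
    and Q: "\<And>x. x \<in> {a..b} \<Longrightarrow> w' x \<le> Q" and st: "a \<le> s" "s \<le> t" "t \<le> b"
  shows "w t - w s \<le> Q * (t - s)"
proof -
  have "Q * s - w s \<le> Q * t - w t"
  proof (rule DERIV_nonneg_imp_increasing_open[OF st(2)])
    fix x assume x: "s < x" "x < t"
    then have "((\<lambda>x. Q * x - w x) has_real_derivative Q - w' x) (at x)"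
      using st by (auto intro!: derivative_eq_intros has_real_derivative_Icc_at[OF w])
    then show "\<exists>y. ((\<lambda>x. Q * x - w x) has_real_derivative y) (at x) \<and> 0 \<le> y"
      using Q[of x] x st by (intro exI[of _ "Q - w' x"]) auto
  next
    have "continuous_on {a..b} w"
      using w by (rule DERIV_continuous_on)
    then show "continuous_on {s..t} (\<lambda>x. Q * x - w x)"
      using st by (intro continuous_intros) (auto elim: continuous_on_subset)
  qed
  then show ?thesis by (simp add: algebra_simps)
qed

text \<open>The truncation of the flux. Its values stay between \<open>- \<bar>K\<bar>\<close> and
  \<open>\<bar>K\<bar>\<close>, which bounds the slope of \<open>v\<close>.\<close>

definition clamp_sym :: "real \<Rightarrow> real \<Rightarrow> real" where
  "clamp_sym K x = max (- K) (min K x)"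

text \<open>The problem in the radius alone: \<open>\<rho>\<close> stands for
  \<open>t ^ (N - 1)\<close> and \<open>\<psi>\<close> for the inverse of \<phi>.
  \<open>G_left\<close> and \<open>G_right\<close> are the two averaging conditions in integrated
  form, with the volume of the annulus multiplied out, asked of functions that are continuously
  differentiable up to the endpoints, as trajectories are.\<close>

locale neumann_bvp =
  fixes a b :: real and \<rho> \<psi> :: "real \<Rightarrow> real" and G :: "real \<Rightarrow> real \<Rightarrow> real" and C0 :: real
  assumes ab: "a < b"
    and rho_cont: "continuous_on {a..b} \<rho>" and rho_pos: "\<And>t. t \<in> {a..b} \<Longrightarrow> \<rho> t > 0"
    and psi_cont: "continuous_on UNIV \<psi>" and psi_mono: "strict_mono \<psi>" and psi_0: "\<psi> 0 = 0"
    and G_cont: "continuous_on ({a..b} \<times> UNIV) (\<lambda>(t, u). G t u)"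
    and C0: "C0 \<ge> 0" and G_lower: "\<And>t u. t \<in> {a..b} \<Longrightarrow> - C0 \<le> G t u"
    and G_const: "\<exists>u0 g0. \<forall>t\<in>{a..b}. G t u0 \<le> g0"
    and G_left: "\<And>\<sigma>. \<exists>d. \<forall>v v'. continuous_on {a..b} v' \<longrightarrow>
        (\<forall>t\<in>{a..b}. (v has_real_derivative v' t) (at t within {a..b})) \<longrightarrow> (\<forall>t\<in>{a..b}. v t \<le> - d) \<longrightarrow>
        integral {a..b} (\<lambda>t. \<rho> t * (\<sigma> - G t (v t))) < 0"
    and G_right: "\<And>\<sigma>. \<exists>d. \<forall>v v'. continuous_on {a..b} v' \<longrightarrow>
        (\<forall>t\<in>{a..b}. (v has_real_derivative v' t) (at t within {a..b})) \<longrightarrow> (\<forall>t\<in>{a..b}. v t \<ge> d) \<longrightarrow>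
        integral {a..b} (\<lambda>t. \<rho> t * (\<sigma> - G t (v t))) < 0"
begin

definition sol :: "real \<Rightarrow> (real \<Rightarrow> real) \<Rightarrow> (real \<Rightarrow> real) \<Rightarrow> bool" where
  "sol s v w \<longleftrightarrow> (\<forall>t\<in>{a..b}. (v has_real_derivative \<psi> (w t / \<rho> t)) (at t within {a..b}) \<and>
      (w has_real_derivative \<rho> t * (s - G t (v t))) (at t within {a..b})) \<and> w a = 0 \<and> w b = 0"

text \<open>The candidates for shooting: the flux vanishes at \<open>a\<close> and is free at
  \<open>b\<close>. It is truncated in the first equation only, so bounds drawn from the second
  equation remain valid.\<close>

definition traj :: "real \<Rightarrow> real \<Rightarrow> (real \<Rightarrow> real) \<Rightarrow> (real \<Rightarrow> real) \<Rightarrow> bool" where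
  "traj K s v w \<longleftrightarrow> (\<forall>t\<in>{a..b}. (v has_real_derivative \<psi> (clamp_sym K (w t) / \<rho> t)) (at t within {a..b}) \<and>
      (w has_real_derivative \<rho> t * (s - G t (v t))) (at t within {a..b})) \<and> w a = 0"

text \<open>In terms of the flux \<open>\<omega>\<close> of \<open>\<beta>\<close>, this says that
  the left-hand side of the equation stays strictly below \<open>s\<close>, with Neumann conditions
  at both ends. The derivative of \<open>\<omega>\<close> is recorded pointwise because it is
  compared at a single touching point.\<close>

definition strict_upper :: "real \<Rightarrow> (real \<Rightarrow> real) \<Rightarrow> (real \<Rightarrow> real) \<Rightarrow> bool" where
  "strict_upper s \<beta> \<omega> \<longleftrightarrow> (\<forall>t\<in>{a..b}. (\<beta> has_real_derivative \<psi> (\<omega> t / \<rho> t)) (at t within {a..b}) \<and>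
      (\<exists>y. (\<omega> has_real_derivative y) (at t within {a..b}) \<and> y < \<rho> t * (s - G t (\<beta> t)))) \<and> \<omega> a = 0 \<and> \<omega> b = 0"

definition rho_max :: real where "rho_max = (SUP t\<in>{a..b}. \<rho> t)"

definition flux_bound :: "real \<Rightarrow> real" where
  "flux_bound s = rho_max * (\<bar>s\<bar> + C0) * (b - a)"

lemma rho_le: "t \<in> {a..b} \<Longrightarrow> \<rho> t \<le> rho_max"
  unfolding rho_max_def
  by (intro cSUP_upper bounded_imp_bdd_above compact_imp_bounded compact_continuous_image rho_cont) auto

lemma rho_max_pos: "rho_max > 0"
  using rho_le[of a] rho_pos[of a] ab by auto

lemma source_le:
  assumes t: "t \<in> {a..b}"
  shows "\<rho> t * (s - G t u) \<le> rho_max * (\<bar>s\<bar> + C0)"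
proof -
  have "\<rho> t * (s - G t u) \<le> \<rho> t * (\<bar>s\<bar> + C0)"
    using rho_pos[OF t] G_lower[OF t, of u] by (intro mult_left_mono) auto
  also have "\<dots> \<le> rho_max * (\<bar>s\<bar> + C0)"
    using rho_le[OF t] C0 by (intro mult_right_mono) auto
  finally show ?thesis .
qed

text \<open>The upper bound on the derivative of \<open>w\<close> bounds \<open>w\<close> from above
  when integrated forward from \<open>w a = 0\<close>, and from below when integrated back from
  \<open>w b = 0\<close>. The result does not depend on \<open>v\<close>.\<close>

lemma flux_bounded:
  assumes w: "\<And>t. t \<in> {a..b} \<Longrightarrow> (w has_real_derivative \<rho> t * (s - G t (v t))) (at t within {a..b})"
    and bc: "w a = 0" "w b = 0" and t: "t \<in> {a..b}"
  shows "\<bar>w t\<bar> \<le> flux_bound s"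
proof -
  let ?Q = "rho_max * (\<bar>s\<bar> + C0)"
  have Q: "?Q \<ge> 0" using rho_max_pos C0 by simp
  have "w t - w a \<le> ?Q * (t - a)" "w b - w t \<le> ?Q * (b - t)"
    using t by (auto intro!: diff_le_of_derivative_le[OF w source_le])
  moreover have "?Q * (t - a) \<le> ?Q * (b - a)" "?Q * (b - t) \<le> ?Q * (b - a)"
    using t by (auto intro!: mult_left_mono[OF _ Q])
  ultimately show ?thesis using bc unfolding flux_bound_def by auto
qed

lemma clamp_sym_eq: "\<bar>x\<bar> \<le> K \<Longrightarrow> clamp_sym K x = x"
  by (auto simp: clamp_sym_def)

text \<open>The flux bound uses only the equation for \<open>w\<close>, which is not truncated, so
  with \<open>w b = 0\<close> the truncation at \<open>K\<close> never acts.\<close>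

lemma traj_imp_sol:
  assumes tr: "traj K s v w" and wb: "w b = 0" and K: "flux_bound s \<le> K"
  shows "sol s v w"
proof -
  have "\<bar>w t\<bar> \<le> flux_bound s" if "t \<in> {a..b}" for t
    using tr wb by (intro flux_bounded[OF _ _ _ that]) (auto simp: traj_def)
  then have "clamp_sym K (w t) = w t" if "t \<in> {a..b}" for t
    using K that by (intro clamp_sym_eq) force
  then show ?thesis using tr wb by (auto simp: traj_def sol_def)
qed

lemma sol_imp_traj:
  assumes sol: "sol s v w" and K: "flux_bound s \<le> K"
  shows "traj K s v w"
proof -
  have "\<bar>w t\<bar> \<le> flux_bound s" if "t \<in> {a..b}" for t
    using sol by (intro flux_bounded[OF _ _ _ that]) (auto simp: sol_def)
  then have "clamp_sym K (w t) = w t" if "t \<in> {a..b}" for t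
    using K that by (intro clamp_sym_eq) force
  then show ?thesis using sol by (auto simp: traj_def sol_def)
qed

text \<open>Truncation confines the argument of \<open>\<psi>\<close> to a compact set, so the bound
  depends on \<open>K\<close> but not on the trajectory.\<close>

lemma speed_bound: "\<exists>M\<ge>0. \<forall>t\<in>{a..b}. \<forall>x. \<bar>\<psi> (clamp_sym K x / \<rho> t)\<bar> \<le> M"
proof -
  have "continuous_on ({-\<bar>K\<bar>..\<bar>K\<bar>} \<times> {a..b}) (\<lambda>p. \<psi> (fst p / \<rho> (snd p)))"
    using rho_pos by (intro continuous_on_compose2[OF psi_cont] continuous_intros
      continuous_on_compose2[OF rho_cont]) fastforce+
  then have "bounded ((\<lambda>p. \<psi> (fst p / \<rho> (snd p))) ` ({-\<bar>K\<bar>..\<bar>K\<bar>} \<times> {a..b}))"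
    by (intro compact_imp_bounded compact_continuous_image compact_Times) auto
  then obtain M where M: "\<And>x t. \<lbrakk>x \<in> {-\<bar>K\<bar>..\<bar>K\<bar>}; t \<in> {a..b}\<rbrakk> \<Longrightarrow> \<bar>\<psi> (x / \<rho> t)\<bar> \<le> M"
    unfolding bounded_iff by fastforce
  have "clamp_sym K x \<in> {-\<bar>K\<bar>..\<bar>K\<bar>}" for x by (auto simp: clamp_sym_def)
  then have "\<bar>\<psi> (clamp_sym K x / \<rho> t)\<bar> \<le> \<bar>M\<bar>" if "t \<in> {a..b}" for x t
    using M[of "clamp_sym K x" t] that by auto
  then show ?thesis by (intro exI[of _ "\<bar>M\<bar>"]) auto
qed

lemma G_cont_comp:
  assumes "continuous_on {a..b} v"
  shows "continuous_on {a..b} (\<lambda>t. G t (v t))"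
proof -
  have "continuous_on {a..b} (\<lambda>t. (\<lambda>(t, u). G t u) (t, v t))"
    using assms by (intro continuous_on_compose2[OF G_cont]) (auto intro!: continuous_intros)
  then show ?thesis by simp
qed

lemma traj_speed_cont:
  assumes "traj K s v w"
  shows "continuous_on {a..b} (\<lambda>t. \<psi> (clamp_sym K (w t) / \<rho> t))"
proof -
  have "continuous_on {a..b} w"
    using assms by (intro DERIV_continuous_on) (auto simp: traj_def)
  then show ?thesis
    unfolding clamp_sym_def using rho_pos
    by (intro continuous_on_compose2[OF psi_cont] continuous_intros rho_cont) fastforce+
qed

lemma flux_integral:
  assumes w: "\<And>t. t \<in> {a..b} \<Longrightarrow> (w has_real_derivative \<rho> t * (s - G t (v t))) (at t within {a..b})"
    and "w a = 0"
  shows "((\<lambda>t. \<rho> t * (s - G t (v t))) has_integral w b) {a..b}"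
  using fundamental_theorem_of_calculus[of a b w "\<lambda>t. \<rho> t * (s - G t (v t))"] ab assms
  by (simp add: has_real_derivative_iff_has_vector_derivative)

text \<open>The final flux is the weighted integral of \<open>s - G\<close>. With bounded slope, a
  trajectory that starts far out stays far out on the same side, where coercivity makes this
  integral negative.\<close>

lemma far_trajectories:
  "\<exists>D. \<forall>v w. traj K s v w \<longrightarrow> D \<le> \<bar>v a\<bar> \<longrightarrow> w b < 0"
proof -
  obtain M where M: "M \<ge> 0" "\<And>t x. t \<in> {a..b} \<Longrightarrow> \<bar>\<psi> (clamp_sym K x / \<rho> t)\<bar> \<le> M"
    using speed_bound by blast
  obtain d1 where d1: "\<And>v v'. \<lbrakk>continuous_on {a..b} v';
      \<And>t. t\<in>{a..b} \<Longrightarrow> (v has_real_derivative v' t) (at t within {a..b}); \<And>t. t\<in>{a..b} \<Longrightarrow> v t \<le> - d1\<rbrakk> \<Longrightarrow>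
      integral {a..b} (\<lambda>t. \<rho> t * (s - G t (v t))) < 0"
    using G_left[of s] by blast
  obtain d2 where d2: "\<And>v v'. \<lbrakk>continuous_on {a..b} v';
      \<And>t. t\<in>{a..b} \<Longrightarrow> (v has_real_derivative v' t) (at t within {a..b}); \<And>t. t\<in>{a..b} \<Longrightarrow> v t \<ge> d2\<rbrakk> \<Longrightarrow>
      integral {a..b} (\<lambda>t. \<rho> t * (s - G t (v t))) < 0"
    using G_right[of s] by blast
  show ?thesis
  proof (intro exI allI impI)
    \<comment> \<open>The margin \<open>M * (b - a)\<close> is the largest distance \<open>v\<close>
      can travel, so \<open>v\<close> stays above \<open>d2\<close> or below
      \<open>- d1\<close>.\<close>
    fix v w assume tr: "traj K s v w" and D: "max d1 d2 + M * (b - a) \<le> \<bar>v a\<bar>"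
    have dv: "(v has_real_derivative \<psi> (clamp_sym K (w t) / \<rho> t)) (at t within {a..b})" if "t \<in> {a..b}" for t
      using tr that by (simp add: traj_def)
    have near: "\<bar>v t - v a\<bar> \<le> M * (b - a)" if t: "t \<in> {a..b}" for t
    proof -
      have "norm (v t - v a) \<le> M * \<bar>t - a\<bar>"
        using dv M t by (intro norm_vector_derivative_bound[where a = a and b = b
          and x' = "\<lambda>t. \<psi> (clamp_sym K (w t) / \<rho> t)"])
          (auto simp: has_real_derivative_iff_has_vector_derivative)
      also have "\<dots> \<le> M * (b - a)" using t M by (intro mult_left_mono) auto
      finally show ?thesis by simp
    qed
    have "integral {a..b} (\<lambda>t. \<rho> t * (s - G t (v t))) < 0"
    proof (cases "v a \<ge> 0")
      case True
      then have "v t \<ge> d2" if "t \<in> {a..b}" for t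
        using near[OF that] D by linarith
      then show ?thesis by (intro d2[OF traj_speed_cont[OF tr]] dv) auto
    next
      case False
      then have "v t \<le> - d1" if "t \<in> {a..b}" for t
        using near[OF that] D by linarith
      then show ?thesis by (intro d1[OF traj_speed_cont[OF tr]] dv) auto
    qed
    then show "w b < 0"
      using flux_integral[of w s v] tr by (auto simp: traj_def dest: integral_unique)
  qed
qed

text \<open>The comparison principle behind the method. The difference \<open>f\<close> of the
  functions has its maximum 0 at \<open>r\<close>, and the difference \<open>g\<close> of the fluxes
  controls the sign of the slope of \<open>f\<close> because \<open>\<psi>\<close> is strictly
  increasing. At \<open>r\<close> both equations see the same value of \<open>G\<close>, so
  strictness gives \<open>g\<close> a positive derivative there. This excludes contact before
  \<open>b\<close>, and contact at \<open>b\<close> forces a positive final flux.\<close>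

lemma touching_trajectory:
  assumes tr: "traj K s v w" and up: "strict_upper s \<beta> \<omega>"
    and K: "\<And>t. t \<in> {a..b} \<Longrightarrow> \<bar>\<omega> t\<bar> < K"
    and le: "\<And>t. t \<in> {a..b} \<Longrightarrow> v t \<le> \<beta> t" and r: "r \<in> {a..b}" "v r = \<beta> r"
  shows "w b > 0"
proof -
  define f where "f t = v t - \<beta> t" for t
  define f' where "f' t = \<psi> (clamp_sym K (w t) / \<rho> t) - \<psi> (\<omega> t / \<rho> t)" for t
  define g where "g t = w t - \<omega> t" for t
  have f_deriv: "(f has_real_derivative f' t) (at t within {a..b})" if "t \<in> {a..b}" for t
    unfolding f_def f'_def using tr up that
    by (auto simp: traj_def strict_upper_def intro!: derivative_eq_intros)
  have f_le: "f t \<le> 0" if "t \<in> {a..b}" for t using le[OF that] by (simp add: f_def)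
  have f_r: "f r = 0" using r by (simp add: f_def)
  have f_cont: "continuous_on {a..b} f" using f_deriv by (rule DERIV_continuous_on)
  obtain y where y: "(\<omega> has_real_derivative y) (at r within {a..b})" "y < \<rho> r * (s - G r (\<beta> r))"
    using up r(1) unfolding strict_upper_def by blast
  have g_deriv: "(g has_real_derivative \<rho> r * (s - G r (\<beta> r)) - y) (at r within {a..b})"
    unfolding g_def using tr y r by (auto simp: traj_def intro!: derivative_eq_intros)
  \<comment> \<open>Since \<open>\<omega> t\<close> lies strictly inside the truncation range,
    truncating \<open>w t\<close> preserves the strict comparison with
    \<open>\<omega> t\<close>.\<close>
  have f'_pos: "f' t > 0" if "t \<in> {a..b}" "g t > 0" for t
  proof -
    have "\<omega> t < clamp_sym K (w t)" using K[OF that(1)] that(2) by (auto simp: clamp_sym_def g_def)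
    then have "\<omega> t / \<rho> t < clamp_sym K (w t) / \<rho> t" using rho_pos[OF that(1)] by (rule divide_strict_right_mono)
    then show ?thesis using psi_mono by (simp add: f'_def strict_mono_less)
  qed
  have f'_neg: "f' t < 0" if "t \<in> {a..b}" "g t < 0" for t
  proof -
    have "\<omega> t > clamp_sym K (w t)" using K[OF that(1)] that(2) by (auto simp: clamp_sym_def g_def)
    then have "clamp_sym K (w t) / \<rho> t < \<omega> t / \<rho> t" using rho_pos[OF that(1)] by (rule divide_strict_right_mono)
    then show ?thesis using psi_mono by (simp add: f'_def strict_mono_less)
  qed
  have ga: "g a = 0" "g b = w b" using tr up by (auto simp: traj_def strict_upper_def g_def)
  \<comment> \<open>Otherwise \<open>r\<close> is not \<open>a\<close>, as \<open>g a = 0\<close>,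
    and \<open>f\<close> is decreasing at \<open>r\<close>, hence positive just to the left.\<close>
  have g_r: "g r \<ge> 0"
  proof (rule ccontr)
    assume neg: "\<not> g r \<ge> 0"
    then have ra: "a < r" using ga r by (cases "r = a") auto
    obtain d where d: "d > 0" "\<And>h. \<lbrakk>h > 0; r - h \<in> {a..b}; h < d\<rbrakk> \<Longrightarrow> f r < f (r - h)"
      using has_real_derivative_neg_dec_left[OF f_deriv[OF r(1)] f'_neg[OF r(1)]] neg by auto
    define h where "h = min (d / 2) (r - a)"
    have h: "h > 0" "h < d" "r - h \<in> {a..b}" using ra d(1) r by (auto simp: h_def min_def)
    have "f (r - h) > 0" using d(2)[OF h(1,3,2)] f_r by simp
    then show False using f_le[OF h(3)] by simp
  qed
  \<comment> \<open>If \<open>r < b\<close>, then \<open>g\<close> is positive just after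
    \<open>r\<close> because \<open>g r\<close> is nonnegative and \<open>g\<close> increases there;
    so \<open>f\<close> would rise above 0.\<close>
  have rb: "r = b"
  proof (rule ccontr)
    assume "r \<noteq> b"
    then have rb: "r < b" using r by auto
    obtain d where d: "d > 0" "\<And>h. \<lbrakk>h > 0; r + h \<in> {a..b}; h < d\<rbrakk> \<Longrightarrow> g r < g (r + h)"
      using has_real_derivative_pos_inc_right[OF g_deriv] y by auto
    define h where "h = min (d / 2) (b - r)"
    have h: "h > 0" "h < d" "r + h \<in> {a..b}" using rb d(1) r by (auto simp: h_def min_def)
    have "f r < f (r + h)"
    proof (rule DERIV_pos_imp_increasing_open[of r "r + h" f])
      fix t assume t: "r < t" "t < r + h"
      then have tab: "t \<in> {a..b}" "a < t" "t < b" using r h by auto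
      have "g t > 0" using d(2)[of "t - r"] t tab h g_r by auto
      then show "\<exists>y. (f has_real_derivative y) (at t) \<and> y > 0"
        using f'_pos tab f_deriv by (blast intro: has_real_derivative_Icc_at)
    qed (use h r in \<open>auto intro: continuous_on_subset[OF f_cont]\<close>)
    then show False using f_r f_le[OF h(3)] by simp
  qed
  \<comment> \<open>If the flux difference vanished at \<open>b\<close>, it would be negative just
    before, so \<open>f\<close> would decrease to 0 and be positive to the left of
    \<open>b\<close>.\<close>
  show "w b > 0"
  proof (rule ccontr)
    assume "\<not> w b > 0"
    then have gb: "g r = 0" using g_r ga rb by simp
    obtain d where d: "d > 0" "\<And>h. \<lbrakk>h > 0; r - h \<in> {a..b}; h < d\<rbrakk> \<Longrightarrow> g (r - h) < g r"
      using has_real_derivative_pos_inc_left[OF g_deriv] y by auto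
    define h where "h = min (d / 2) (b - a)"
    have h: "h > 0" "h < d" "b - h \<in> {a..b}" using ab d(1) r by (auto simp: h_def min_def)
    have "f b < f (b - h)"
    proof (rule DERIV_neg_imp_decreasing_open[of "b - h" b f])
      fix t assume t: "b - h < t" "t < b"
      then have tab: "t \<in> {a..b}" "a < t" "t < b" using r h by auto
      have "g t < 0" using d(2)[of "b - t"] t tab h gb rb by auto
      then show "\<exists>y. (f has_real_derivative y) (at t) \<and> y < 0"
        using f'_neg tab f_deriv by (blast intro: has_real_derivative_Icc_at)
    qed (use h r in \<open>auto intro: continuous_on_subset[OF f_cont]\<close>)
    then show False using f_r rb f_le[OF h(3)] by simp
  qed
qed

text \<open>Below \<open>- C0\<close> the flux is strictly decreasing and cannot return to 0. This
  bounds the solvable levels from below.\<close>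

lemma sol_ge:
  assumes "sol s v w"
  shows "- C0 \<le> s"
proof (rule ccontr)
  assume s: "\<not> - C0 \<le> s"
  have w: "(w has_real_derivative \<rho> t * (s - G t (v t))) (at t within {a..b})" if "t \<in> {a..b}" for t
    using assms that by (simp add: sol_def)
  have "w b < w a"
  proof (rule DERIV_neg_imp_decreasing_open[OF ab])
    fix t assume t: "a < t" "t < b"
    have "\<rho> t * (s - G t (v t)) < 0"
      using rho_pos[of t] G_lower[of t "v t"] s t by (intro mult_pos_neg) auto
    then show "\<exists>y. (w has_real_derivative y) (at t) \<and> y < 0"
      using has_real_derivative_Icc_at[OF w t] t by (meson atLeastAtMost_iff less_imp_le)
  qed (rule DERIV_continuous_on[OF w])
  then show False using assms by (simp add: sol_def)
qed

lemma sol_strict_upper: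
  assumes "sol s1 v w" "s1 < s"
  shows "strict_upper s v w"
  using assms rho_pos by (fastforce simp: sol_def strict_upper_def)

text \<open>A constant has zero flux because \<psi> vanishes at 0. This is how solvability starts at
  some level.\<close>

lemma const_strict_upper:
  assumes "\<And>t. t \<in> {a..b} \<Longrightarrow> G t u0 < s"
  shows "strict_upper s (\<lambda>_. u0) (\<lambda>_. 0)"
  using assms rho_pos psi_0 by (auto simp: strict_upper_def intro!: exI[of _ 0])

section \<open>Limits of trajectories and closedness of the solvable levels\<close>

lemma system_continuous:
  "continuous_on (UNIV \<times> {a..b} \<times> UNIV)
    (\<lambda>(s, t, x). (\<psi> (clamp_sym K (snd x) / \<rho> t), \<rho> t * (s - G t (fst x))))"
proof -
  have "continuous_on (UNIV \<times> {a..b} \<times> UNIV) (\<lambda>q::real \<times> real \<times> real \<times> real. \<psi> (clamp_sym K (snd (snd (snd q))) / \<rho> (fst (snd q))))"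
    unfolding clamp_sym_def using rho_pos
    by (intro continuous_on_compose2[OF psi_cont] continuous_intros continuous_on_compose2[OF rho_cont]) fastforce+
  moreover have "continuous_on (UNIV \<times> {a..b} \<times> UNIV)
      (\<lambda>q::real \<times> real \<times> real \<times> real. (\<lambda>(t, u). G t u) (fst (snd q), fst (snd (snd q))))"
    by (intro continuous_on_compose2[OF G_cont] continuous_intros) auto
  then have "continuous_on (UNIV \<times> {a..b} \<times> UNIV)
      (\<lambda>q::real \<times> real \<times> real \<times> real. \<rho> (fst (snd q)) * (fst q - G (fst (snd q)) (fst (snd (snd q)))))"
    by (intro continuous_intros continuous_on_compose2[OF rho_cont]) auto
  ultimately show ?thesis
    unfolding case_prod_beta by (rule continuous_on_Pair)
qed

text \<open>Control of \<open>v\<close> at one point of the interval suffices: bounded slope spreads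
  it to the whole interval, then the source is bounded, and \<open>w a = 0\<close> bounds
  \<open>w\<close>. The pairs of \<open>v\<close> and \<open>w\<close> thus meet the hypotheses of
  \<open>delay_equation_limit\<close>.\<close>

lemma limit_trajectory:
  assumes s: "s \<longlonglongrightarrow> s0" and d: "\<delta> \<longlonglongrightarrow> 0" "\<And>k. 0 \<le> \<delta> k"
    and v: "\<And>k t. t \<in> {a..b} \<Longrightarrow>
      (v k has_real_derivative \<psi> (clamp_sym K (w k (max a (t - \<delta> k))) / \<rho> t)) (at t within {a..b})"
    and w: "\<And>k t. t \<in> {a..b} \<Longrightarrow>
      (w k has_real_derivative \<rho> t * (s k - G t (v k (max a (t - \<delta> k))))) (at t within {a..b})"
    and wa: "\<And>k. w k a = 0"
    and va: "\<And>k. \<exists>t\<in>{a..b}. \<bar>v k t\<bar> \<le> C"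
  obtains r v0 w0 where "strict_mono (r :: nat \<Rightarrow> nat)"
    "uniform_limit {a..b} (\<lambda>k. v (r k)) v0 sequentially"
    "uniform_limit {a..b} (\<lambda>k. w (r k)) w0 sequentially"
    "traj K s0 v0 w0"
proof -
  obtain M where M: "M \<ge> 0" "\<And>t x. t \<in> {a..b} \<Longrightarrow> \<bar>\<psi> (clamp_sym K x / \<rho> t)\<bar> \<le> M"
    using speed_bound by blast
  have lag: "max a (t - \<delta> k) \<in> {a..b}" if "t \<in> {a..b}" for t k
    using that d(2)[of k] by auto
  define E where "E = C + M * (b - a)"
  have vE: "\<bar>v k t\<bar> \<le> E" if t: "t \<in> {a..b}" for k t
  proof -
    obtain t' where t': "t' \<in> {a..b}" "\<bar>v k t'\<bar> \<le> C" using va by blast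
    have "norm (v k t - v k t') \<le> M * \<bar>t - t'\<bar>"
      using v M t t' by (intro norm_vector_derivative_bound[where a = a and b = b
        and x' = "\<lambda>t. \<psi> (clamp_sym K (w k (max a (t - \<delta> k))) / \<rho> t)"])
        (auto simp: has_real_derivative_iff_has_vector_derivative)
    also have "\<dots> \<le> M * (b - a)" using t t' M by (intro mult_left_mono) auto
    finally show ?thesis using t' by (auto simp: E_def)
  qed
  obtain S where S: "\<And>k. \<bar>s k\<bar> \<le> S"
    using s by (metis Bseq_def convergentI convergent_imp_Bseq real_norm_def)
  have cont: "continuous_on ({-S..S} \<times> {a..b} \<times> {-E..E}) (\<lambda>q. \<rho> (fst (snd q)) * (fst q - (\<lambda>(t, u). G t u) (snd q)))"
    by (intro continuous_intros continuous_on_compose2[OF rho_cont] continuous_on_compose2[OF G_cont]) auto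
  have "bounded ((\<lambda>q. \<rho> (fst (snd q)) * (fst q - (\<lambda>(t, u). G t u) (snd q))) ` ({-S..S} \<times> {a..b} \<times> {-E..E}))"
    by (intro compact_imp_bounded compact_continuous_image[OF cont] compact_Times compact_Icc)
  then obtain Q where "\<forall>x\<in>(\<lambda>q. \<rho> (fst (snd q)) * (fst q - (\<lambda>(t, u). G t u) (snd q))) ` ({-S..S} \<times> {a..b} \<times> {-E..E}). norm x \<le> Q"
    unfolding bounded_iff by blast
  then have Q: "\<bar>\<rho> t * (s' - G t u)\<bar> \<le> Q" if "\<bar>s'\<bar> \<le> S" "t \<in> {a..b}" "\<bar>u\<bar> \<le> E" for s' t u
    using that by (force simp: abs_le_iff)
  have Q0: "Q \<ge> 0" using Q[OF S, of a 0 0] Q[OF S, of a "v 0 a" 0] vE[of a 0] ab by fastforce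
  have wQ: "\<bar>w k t\<bar> \<le> Q * (b - a)" if t: "t \<in> {a..b}" for k t
  proof -
    have "norm (w k t - w k a) \<le> Q * \<bar>t - a\<bar>"
      using w Q[OF S _ vE[OF lag]] t ab by (intro norm_vector_derivative_bound[where a = a and b = b
        and x' = "\<lambda>t. \<rho> t * (s k - G t (v k (max a (t - \<delta> k))))"])
        (auto simp: has_real_derivative_iff_has_vector_derivative)
    also have "\<dots> \<le> Q * (b - a)" using t Q0 by (intro mult_left_mono) auto
    finally show ?thesis using wa by simp
  qed
  define f where "f s t x = (\<psi> (clamp_sym K (snd x) / \<rho> t), \<rho> t * (s - G t (fst x)))" for s t :: real and x :: "real \<times> real"
  define x where "x k t = (v k t, w k t)" for k t
  have "continuous_on (UNIV \<times> {a..b} \<times> UNIV) (\<lambda>(s, t, x). f s t x)"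
    unfolding f_def by (rule system_continuous)
  moreover have "(x k has_vector_derivative f (s k) t (x k (max a (t - \<delta> k)))) (at t within {a..b})"
    if "t \<in> {a..b}" for k t
    unfolding x_def f_def using v[OF that] w[OF that]
    by (auto simp: has_real_derivative_iff_has_vector_derivative intro: has_vector_derivative_Pair)
  moreover have "norm (x k t) \<le> E + Q * (b - a)" if "t \<in> {a..b}" for k t
    using norm_Pair_le[of "v k t" "w k t"] vE[OF that, of k] wQ[OF that, of k] by (simp add: x_def)
  ultimately obtain r y where r: "strict_mono (r :: nat \<Rightarrow> nat)"
    and ul: "uniform_limit {a..b} (\<lambda>k. x (r k)) y sequentially"
    and y: "\<And>t. t \<in> {a..b} \<Longrightarrow> (y has_vector_derivative f s0 t (y t)) (at t within {a..b})"
    using delay_equation_limit[OF _ s d, of a b f x] by metis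
  have ulv: "uniform_limit {a..b} (\<lambda>k. v (r k)) (\<lambda>t. fst (y t)) sequentially"
    using bounded_linear.uniform_limit[OF bounded_linear_fst ul] by (simp add: x_def)
  have ulw: "uniform_limit {a..b} (\<lambda>k. w (r k)) (\<lambda>t. snd (y t)) sequentially"
    using bounded_linear.uniform_limit[OF bounded_linear_snd ul] by (simp add: x_def)
  have "(\<lambda>k. w (r k) a) \<longlonglongrightarrow> snd (y a)"
    using tendsto_uniform_limitI[OF ulw] ab by auto
  then have "snd (y a) = 0" using wa by (simp add: LIMSEQ_const_iff)
  moreover have "((\<lambda>t. fst (y t)) has_vector_derivative fst (f s0 t (y t))) (at t within {a..b})"
      "((\<lambda>t. snd (y t)) has_vector_derivative snd (f s0 t (y t))) (at t within {a..b})" if "t \<in> {a..b}" for t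
    using bounded_linear.has_vector_derivative[OF bounded_linear_fst y[OF that]]
      bounded_linear.has_vector_derivative[OF bounded_linear_snd y[OF that]] by auto
  ultimately have "traj K s0 (\<lambda>t. fst (y t)) (\<lambda>t. snd (y t))"
    by (auto simp: traj_def f_def has_real_derivative_iff_has_vector_derivative)
  then show ?thesis using that r ulv ulw by blast
qed

definition delay_family :: "real \<Rightarrow> real \<Rightarrow> real \<Rightarrow> (real \<Rightarrow> real \<Rightarrow> real) \<Rightarrow> (real \<Rightarrow> real \<Rightarrow> real) \<Rightarrow> bool" where
  "delay_family K s \<delta> V W \<longleftrightarrow>
    continuous_on (UNIV \<times> {a..b}) (\<lambda>p. V (fst p) (snd p)) \<and>
    continuous_on (UNIV \<times> {a..b}) (\<lambda>p. W (fst p) (snd p)) \<and>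
    (\<forall>c. V c a = c \<and> W c a = 0) \<and>
    (\<forall>c. \<forall>t\<in>{a..b}. (V c has_real_derivative \<psi> (clamp_sym K (W c (max a (t - \<delta>))) / \<rho> t)) (at t within {a..b}) \<and>
      (W c has_real_derivative \<rho> t * (s - G t (V c (max a (t - \<delta>))))) (at t within {a..b}))"

lemma delay_family_exists:
  assumes d: "\<delta> > 0"
  shows "\<exists>V W. delay_family K s \<delta> V W"
proof -
  define f where "f t x = (\<psi> (clamp_sym K (snd x) / \<rho> t), \<rho> t * (s - G t (fst x)))" for t :: real and x :: "real \<times> real"
  have "continuous_on ({a..b} \<times> UNIV)
     (\<lambda>q. (\<lambda>(s, t, x). (\<psi> (clamp_sym K (snd x) / \<rho> t), \<rho> t * (s - G t (fst x)))) (s, fst q, snd q))"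
    by (intro continuous_on_compose2[OF system_continuous]) (auto intro!: continuous_intros)
  then have "continuous_on ({a..b} \<times> UNIV) (\<lambda>(t, x). f t x)"
    by (simp add: f_def case_prod_beta)
  from delay_equation_solution[OF less_imp_le[OF ab] this d]
  obtain X where X: "continuous_on (UNIV \<times> {a..b}) (\<lambda>(c, t). X c t)" "\<And>c. X c a = c"
    "\<And>c t. t \<in> {a..b} \<Longrightarrow> (X c has_vector_derivative f t (X c (max a (t - \<delta>)))) (at t within {a..b})"
    by metis
  have "continuous_on (UNIV \<times> {a..b}) (\<lambda>p. (\<lambda>(c, t). X c t) ((fst p, 0), snd p))"
    by (intro continuous_on_compose2[OF X(1)]) (auto intro!: continuous_intros)
  then have "continuous_on (UNIV \<times> {a..b}) (\<lambda>p. fst (X (fst p, 0) (snd p)))"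
    "continuous_on (UNIV \<times> {a..b}) (\<lambda>p. snd (X (fst p, 0) (snd p)))"
    by (auto intro!: continuous_intros)
  moreover have "((\<lambda>t. fst (X c t)) has_vector_derivative fst (f t (X c (max a (t - \<delta>))))) (at t within {a..b})"
      "((\<lambda>t. snd (X c t)) has_vector_derivative snd (f t (X c (max a (t - \<delta>))))) (at t within {a..b})" if "t \<in> {a..b}" for t c
    using bounded_linear.has_vector_derivative[OF bounded_linear_fst X(3)[OF that]]
      bounded_linear.has_vector_derivative[OF bounded_linear_snd X(3)[OF that]] by auto
  ultimately show ?thesis
    unfolding delay_family_def by (intro exI[of _ "\<lambda>c t. fst (X (c, 0) t)"] exI[of _ "\<lambda>c t. snd (X (c, 0) t)"])
      (auto simp: X(2) f_def has_real_derivative_iff_has_vector_derivative)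
qed

text \<open>A bound \<open>S\<close> on the levels gives one truncation level \<open>K\<close> for
  all of them. Coercivity prevents the solutions from escaping to infinity, and compactness with
  zero delay does the rest.\<close>

lemma solvable_closed:
  assumes sol: "\<And>k. sol (s k) (v k) (w k)" and s: "s \<longlonglongrightarrow> s0"
  shows "\<exists>v w. sol s0 v w"
proof -
  obtain S where S: "\<And>k. \<bar>s k\<bar> \<le> S"
    using s by (metis Bseq_def convergentI convergent_imp_Bseq real_norm_def)
  define K where "K = flux_bound S"
  have fK: "flux_bound s' \<le> K" if "\<bar>s'\<bar> \<le> S" for s'
    unfolding K_def flux_bound_def using that rho_max_pos C0 ab
    by (intro mult_right_mono mult_left_mono) auto
  have tr: "traj K (s k) (v k) (w k)" for k
    using sol_imp_traj[OF sol fK[OF S]] .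
  obtain d1 where d1: "\<And>v v'. \<lbrakk>continuous_on {a..b} v';
      \<And>t. t\<in>{a..b} \<Longrightarrow> (v has_real_derivative v' t) (at t within {a..b}); \<And>t. t\<in>{a..b} \<Longrightarrow> v t \<le> - d1\<rbrakk> \<Longrightarrow>
      integral {a..b} (\<lambda>t. \<rho> t * (S - G t (v t))) < 0"
    using G_left[of S] by blast
  obtain d2 where d2: "\<And>v v'. \<lbrakk>continuous_on {a..b} v';
      \<And>t. t\<in>{a..b} \<Longrightarrow> (v has_real_derivative v' t) (at t within {a..b}); \<And>t. t\<in>{a..b} \<Longrightarrow> v t \<ge> d2\<rbrakk> \<Longrightarrow>
      integral {a..b} (\<lambda>t. \<rho> t * (S - G t (v t))) < 0"
    using G_right[of S] by blast
  \<comment> \<open>A solution that avoids this band keeps one sign by the intermediate value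
    theorem, so it lies entirely in the range of one coercivity condition at level
    \<open>S\<close>.\<close>
  have C: "\<exists>t\<in>{a..b}. \<bar>v k t\<bar> \<le> max \<bar>d1\<bar> \<bar>d2\<bar>" for k
  proof (rule ccontr)
    assume neg: "\<not> (\<exists>t\<in>{a..b}. \<bar>v k t\<bar> \<le> max \<bar>d1\<bar> \<bar>d2\<bar>)"
    have dv: "(v k has_real_derivative \<psi> (clamp_sym K (w k t) / \<rho> t)) (at t within {a..b})" if "t \<in> {a..b}" for t
      using tr[of k] that by (simp add: traj_def)
    have vc: "continuous_on {a..b} (v k)" using dv by (rule DERIV_continuous_on)
    have "(\<forall>t\<in>{a..b}. v k t \<le> - d1) \<or> (\<forall>t\<in>{a..b}. v k t \<ge> d2)"
    proof (rule ccontr)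
      assume "\<not> ?thesis"
      then obtain t t' where t: "t \<in> {a..b}" "t' \<in> {a..b}" "v k t > - d1" "v k t' < d2" by force
      with neg have *: "v k t > 0" "v k t' < 0" by force+
      have "is_interval {a..b}" by simp
      then have "is_interval (v k ` {a..b})"
        using connected_continuous_image[OF vc] by (simp add: is_interval_connected_1)
      then have "0 \<in> v k ` {a..b}"
        using mem_is_interval_1_I[of "v k ` {a..b}" "v k t'" "v k t" 0] * t by auto
      then show False using neg by force
    qed
    then have "integral {a..b} (\<lambda>t. \<rho> t * (S - G t (v k t))) < 0"
      using d1[OF traj_speed_cont[OF tr] dv] d2[OF traj_speed_cont[OF tr] dv] by blast
    \<comment> \<open>At the level \<open>s k\<close> this integral equals \<open>w k b = 0\<close>,
      and raising the level to \<open>S\<close> can only increase it.\<close>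
    moreover have "0 \<le> integral {a..b} (\<lambda>t. \<rho> t * (S - G t (v k t)))"
    proof (rule has_integral_le)
      show "((\<lambda>t. \<rho> t * (s k - G t (v k t))) has_integral 0) {a..b}"
        using flux_integral[of "w k" "s k" "v k"] sol[of k] by (auto simp: sol_def)
      show "((\<lambda>t. \<rho> t * (S - G t (v k t))) has_integral integral {a..b} (\<lambda>t. \<rho> t * (S - G t (v k t)))) {a..b}"
        by (intro integrable_integral integrable_continuous_real continuous_intros rho_cont G_cont_comp vc)
      show "\<rho> t * (s k - G t (v k t)) \<le> \<rho> t * (S - G t (v k t))" if "t \<in> {a..b}" for t
        using rho_pos[OF that] S[of k] by (intro mult_left_mono) auto
    qed
    ultimately show False by simp
  qed
  have "\<exists>r v0 w0. strict_mono (r :: nat \<Rightarrow> nat) \<and>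
    uniform_limit {a..b} (\<lambda>k. w (r k)) w0 sequentially \<and> traj K s0 v0 w0"
  proof (rule limit_trajectory[where \<delta> = "\<lambda>_. 0" and v = v and w = w and C = "max \<bar>d1\<bar> \<bar>d2\<bar>", OF s])
    fix k t assume t: "t \<in> {a..b}"
    then have [simp]: "max a (t - 0) = t" by simp
    show "(v k has_real_derivative \<psi> (clamp_sym K (w k (max a (t - 0))) / \<rho> t)) (at t within {a..b})"
      "(w k has_real_derivative \<rho> t * (s k - G t (v k (max a (t - 0))))) (at t within {a..b})"
      using tr[of k] t by (simp_all add: traj_def)
  qed (use tr C in \<open>auto simp: traj_def\<close>)
  then obtain r v0 w0 where ul: "uniform_limit {a..b} (\<lambda>k. w (r k)) w0 sequentially" and tr0: "traj K s0 v0 w0"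
    by blast
  have "(\<lambda>k. w (r k) b) \<longlonglongrightarrow> w0 b"
    using tendsto_uniform_limitI[OF ul] ab by auto
  then have "w0 b = 0" using sol by (simp add: sol_def LIMSEQ_const_iff)
  moreover have "\<bar>s0\<bar> \<le> S"
    using LIMSEQ_le_const2[OF tendsto_rabs[OF s]] S by blast
  ultimately show ?thesis using traj_imp_sol[OF tr0 _ fK] by blast
qed

end

section \<open>Shooting on either side of an upper solution\<close>

text \<open>\<open>H\<close> collects the parameters whose trajectory reaches
  \<open>\<beta>\<close>, \<open>L\<close> those whose trajectory never exceeds it. Both are closed,
  so the trajectories at \<open>Inf H\<close> and \<open>Sup L\<close> touch \<open>\<beta>\<close>
  without crossing and have positive final flux. The intermediate value theorem against the negative
  values at \<open>- C\<close> and \<open>C\<close> gives a zero on each side.\<close>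

lemma crossing_parameters:
  fixes V W :: "real \<Rightarrow> real \<Rightarrow> real" and \<beta> :: "real \<Rightarrow> real"
  assumes ab: "a \<le> b"
    and V: "continuous_on (UNIV \<times> {a..b}) (\<lambda>p. V (fst p) (snd p))" and W: "continuous_on UNIV (\<lambda>c. W c b)"
    and \<beta>: "continuous_on {a..b} \<beta>" and C: "- C < C"
    and low: "\<And>t. t \<in> {a..b} \<Longrightarrow> V (- C) t < \<beta> t" and high: "\<beta> a < V C a"
    and ends: "W (- C) b < 0" "W C b < 0"
    and touch: "\<And>c r. \<lbrakk>c \<in> {-C..C}; r \<in> {a..b}; V c r = \<beta> r; \<And>t. t \<in> {a..b} \<Longrightarrow> V c t \<le> \<beta> t\<rbrakk> \<Longrightarrow> W c b > 0"
  shows "(\<exists>c\<in>{-C..C}. W c b = 0 \<and> (\<forall>t\<in>{a..b}. V c t \<le> \<beta> t)) \<and>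
         (\<exists>c\<in>{-C..C}. W c b = 0 \<and> (\<exists>t\<in>{a..b}. \<beta> t \<le> V c t))"
proof -
  have Vc: "continuous_on T (\<lambda>c. V c t)" if t: "t \<in> {a..b}" for t T
    using t by (intro continuous_on_compose2[OF V, of T "\<lambda>c. (c, t)", simplified]) (auto intro!: continuous_intros)
  have Wc: "continuous_on T (\<lambda>c. W c b)" for T
    using W by (rule continuous_on_subset) simp
  define H where "H = {c \<in> {-C..C}. \<exists>t\<in>{a..b}. \<beta> t \<le> V c t}"
  define L where "L = {c \<in> {-C..C}. \<forall>t\<in>{a..b}. V c t \<le> \<beta> t}"
  \<comment> \<open>\<open>H\<close> is the projection of this compact set, hence closed.\<close>
  let ?Z = "{p \<in> {-C..C} \<times> {a..b}. \<beta> (snd p) \<le> V (fst p) (snd p)}"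
  have "closed ?Z"
    by (intro continuous_on_closed_Collect_le continuous_on_compose2[OF \<beta>] continuous_on_subset[OF V]
      continuous_intros closed_Times) auto
  then have "compact (({-C..C} \<times> {a..b}) \<inter> ?Z)"
    by (intro compact_Int_closed compact_Times compact_Icc)
  then have "compact (fst ` (({-C..C} \<times> {a..b}) \<inter> ?Z))"
    by (intro compact_continuous_image continuous_intros)
  moreover have "fst ` (({-C..C} \<times> {a..b}) \<inter> ?Z) = H"
    by (force simp: H_def)
  ultimately have H_closed: "closed H" by (simp add: compact_imp_closed)
  have C_in: "C \<in> H" "C \<notin> L" using C high ab by (auto simp: H_def L_def intro!: bexI[of _ a])
  have mC_in: "- C \<notin> H" "- C \<in> L" using C low by (force simp: H_def L_def)+
  have touchH: "W c b > 0" if cH: "c \<in> H" and le: "\<And>t. t \<in> {a..b} \<Longrightarrow> V c t \<le> \<beta> t" for c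
  proof -
    obtain r where r: "r \<in> {a..b}" "\<beta> r \<le> V c r" and c: "c \<in> {-C..C}"
      using cH by (auto simp: H_def)
    then have "V c r = \<beta> r" using le[OF r(1)] by simp
    then show ?thesis using touch[OF c r(1)] le by blast
  qed
  have "\<exists>c\<in>{-C..C}. W c b = 0 \<and> (\<forall>t\<in>{a..b}. V c t \<le> \<beta> t)"
  proof -
    define c0 where "c0 = Inf H"
    have bdd: "bdd_below H" by (rule bdd_belowI[of _ "- C"]) (auto simp: H_def)
    have c0: "c0 \<in> H" unfolding c0_def using C_in bdd H_closed by (intro closed_contains_Inf) auto
    have below: "V c t \<le> \<beta> t" if "c \<in> {-C..<c0}" "t \<in> {a..b}" for c t
    proof -
      have "c \<notin> H" using cInf_lower[OF _ bdd, of c] that by (auto simp: c0_def)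
      moreover have "c \<in> {-C..C}" using that c0 by (auto simp: H_def)
      ultimately show ?thesis using that by (force simp: H_def)
    qed
    have mc0: "- C < c0" using c0 mC_in by (cases "c0 = - C") (auto simp: H_def)
    \<comment> \<open>All smaller parameters lie outside \<open>H\<close>, and the inequality passes
      to the limit \<open>c0\<close> by continuity in \<open>c\<close>.\<close>
    have "V c0 t \<le> \<beta> t" if t: "t \<in> {a..b}" for t
      using mc0 below[OF _ t]
      by (intro continuous_le_on_closure[OF Vc[OF t], of c0 "{-C..<c0}"]) auto
    then have pos: "W c0 b > 0" by (intro touchH c0)
    have "\<exists>c\<ge>- C. c \<le> c0 \<and> W c b = 0"
      using mc0 pos ends by (intro IVT' Wc) auto
    then obtain c where c: "- C \<le> c" "c \<le> c0" "W c b = 0" by blast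
    \<comment> \<open>The zero is strictly before \<open>c0\<close>, where the trajectories stay
      below \<open>\<beta>\<close>.\<close>
    then have "c \<in> {-C..<c0}" using pos by (cases "c = c0") auto
    with below c show ?thesis using c0 by (intro bexI[of _ c]) (auto simp: H_def)
  qed
  moreover have "\<exists>c\<in>{-C..C}. W c b = 0 \<and> (\<exists>t\<in>{a..b}. \<beta> t \<le> V c t)"
  proof -
    define c0 where "c0 = Sup L"
    have bdd: "bdd_above L" by (rule bdd_aboveI[of _ "C"]) (auto simp: L_def)
    have "L = (\<Inter>t\<in>{a..b}. {c \<in> {-C..C}. V c t \<le> \<beta> t})"
      using ab by (auto simp: L_def)
    moreover have "closed (\<Inter>t\<in>{a..b}. {c \<in> {-C..C}. V c t \<le> \<beta> t})"
      by (intro closed_INT ballI continuous_on_closed_Collect_le Vc continuous_intros) auto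
    ultimately have c0: "c0 \<in> L" unfolding c0_def using mC_in bdd by (intro closed_contains_Sup) auto
    have c0C: "c0 < C" using c0 C_in by (cases "c0 = C") (auto simp: L_def)
    have above: "c \<in> H" if "c \<in> {c0<..C}" for c
    proof -
      have "c \<notin> L" using cSup_upper[OF _ bdd, of c] that by (auto simp: c0_def)
      moreover have "c \<in> {-C..C}" using that c0 by (auto simp: L_def)
      ultimately show ?thesis by (force simp: H_def L_def)
    qed
    \<comment> \<open>Parameters beyond \<open>Sup L\<close> are in \<open>H\<close>; closedness
      adds \<open>c0\<close> itself, which therefore lies in both sets.\<close>
    then have "closure {c0<..C} \<subseteq> H" using H_closed by (intro closure_minimal) auto
    then have H: "{c0..C} \<subseteq> H" using c0C by simp
    have pos: "W c0 b > 0" using c0 H c0C by (intro touchH) (auto simp: L_def)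
    have "\<exists>c\<ge>c0. c \<le> C \<and> W c b = 0"
      using c0C pos ends by (intro IVT2' Wc) auto
    then show ?thesis using H by (force simp: H_def)
  qed
  ultimately show ?thesis by blast
qed

text \<open>If the limit stayed strictly below \<open>\<beta>\<close>, the gap would have a positive
  minimum on the compact interval, and uniform convergence would keep late members below
  \<open>\<beta>\<close> as well.\<close>

lemma uniform_limit_touch:
  fixes v :: "nat \<Rightarrow> real \<Rightarrow> real"
  assumes ul: "uniform_limit {a..b} v v0 sequentially"
    and v0: "continuous_on {a..b} v0" and \<beta>: "continuous_on {a..b} \<beta>"
    and ex: "\<And>k. \<exists>t\<in>{a..b}. \<beta> t \<le> v k t"
  shows "\<exists>t\<in>{a..b}. \<beta> t \<le> v0 t"
proof (rule ccontr)
  assume "\<not> ?thesis"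
  then have lt: "v0 t < \<beta> t" if "t \<in> {a..b}" for t using that by force
  have ne: "{a..b} \<noteq> {}" using ex by blast
  obtain m where m: "m \<in> {a..b}" "\<And>t. t \<in> {a..b} \<Longrightarrow> \<beta> m - v0 m \<le> \<beta> t - v0 t"
    using continuous_attains_inf[OF compact_Icc ne continuous_on_diff[OF \<beta> v0]] by blast
  have "\<forall>\<^sub>F k in sequentially. \<forall>t\<in>{a..b}. dist (v k t) (v0 t) < \<beta> m - v0 m"
    using ul lt[OF m(1)] by (intro uniform_limitD) auto
  then obtain k where k: "\<And>t. t \<in> {a..b} \<Longrightarrow> dist (v k t) (v0 t) < \<beta> m - v0 m"
    unfolding eventually_sequentially by blast
  obtain t where "t \<in> {a..b}" "\<beta> t \<le> v k t" using ex by blast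
  with k[of t] m(2)[of t] show False by (auto simp: dist_real_def)
qed

section \<open>Two solutions below an upper solution level, and the threshold\<close>

context neumann_bvp begin

text \<open>Shooting is done with small positive delays, where \<open>crossing_parameters\<close>
  supplies two parameters for each delay. Their trajectories subconverge to solutions: one stays
  below \<open>\<beta>\<close>, the other reaches it. The first cannot touch \<open>\<beta>\<close>,
  since its final flux is 0, so the two differ.\<close>

lemma two_solutions:
  assumes up: "strict_upper s \<beta> \<omega>"
  shows "\<exists>v1 w1 v2 w2. sol s v1 w1 \<and> sol s v2 w2 \<and> (\<exists>t\<in>{a..b}. v1 t \<noteq> v2 t)"
proof -
  have d\<beta>: "(\<beta> has_real_derivative \<psi> (\<omega> t / \<rho> t)) (at t within {a..b})" if "t \<in> {a..b}" for t
    using up that by (simp add: strict_upper_def)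
  have \<beta>c: "continuous_on {a..b} \<beta>" using d\<beta> by (rule DERIV_continuous_on)
  have "continuous_on {a..b} \<omega>"
    unfolding continuous_on_eq_continuous_within
    using up by (auto simp: strict_upper_def intro: DERIV_continuous)
  then obtain B\<omega> where B\<omega>: "\<And>t. t \<in> {a..b} \<Longrightarrow> \<bar>\<omega> t\<bar> \<le> B\<omega>"
    using compact_imp_bounded[OF compact_continuous_image[OF _ compact_Icc]] by (fastforce simp: bounded_iff)
  obtain B\<beta> where B\<beta>: "\<And>t. t \<in> {a..b} \<Longrightarrow> \<bar>\<beta> t\<bar> \<le> B\<beta>"
    using compact_imp_bounded[OF compact_continuous_image[OF \<beta>c compact_Icc]] by (fastforce simp: bounded_iff)
  \<comment> \<open>The first entry makes trajectories with zero final flux genuine solutions; the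
    second keeps \<open>\<omega>\<close> strictly inside the truncation range.\<close>
  define K where "K = max (flux_bound s) (B\<omega> + 1)"
  have K: "flux_bound s \<le> K" "\<And>t. t \<in> {a..b} \<Longrightarrow> \<bar>\<omega> t\<bar> < K"
    using B\<omega> by (force simp: K_def)+
  obtain M where M: "M \<ge> 0" "\<And>t x. t \<in> {a..b} \<Longrightarrow> \<bar>\<psi> (clamp_sym K x / \<rho> t)\<bar> \<le> M"
    using speed_bound by blast
  obtain D where D: "\<And>v w. \<lbrakk>traj K s v w; D \<le> \<bar>v a\<bar>\<rbrakk> \<Longrightarrow> w b < 0"
    using far_trajectories by blast
  \<comment> \<open>The first entry gives negative final flux at both ends of the parameter range;
    the second keeps every trajectory from \<open>- C\<close> below \<open>\<beta>\<close>
    throughout and starts the one from \<open>C\<close> above it.\<close>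
  define C where "C = max D (B\<beta> + M * (b - a) + 1)"
  have Mab: "M * (b - a) \<ge> 0" using M ab by simp
  have C: "D \<le> C" "B\<beta> + M * (b - a) < C" "0 < C" using B\<beta>[of a] ab Mab by (auto simp: C_def)
  have "\<exists>V W. \<forall>\<delta>>0. delay_family K s \<delta> (V \<delta>) (W \<delta>)"
    using delay_family_exists[of _ K s] by metis
  then obtain V W where fam: "\<And>\<delta>. \<delta> > 0 \<Longrightarrow> delay_family K s \<delta> (V \<delta>) (W \<delta>)"
    by blast
  note fam = fam[unfolded delay_family_def]
  have Vc: "continuous_on (UNIV \<times> {a..b}) (\<lambda>p. V \<delta> (fst p) (snd p))"
    and Wc: "continuous_on (UNIV \<times> {a..b}) (\<lambda>p. W \<delta> (fst p) (snd p))"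
    and Va: "V \<delta> c a = c" and Wa: "W \<delta> c a = 0"
    if "\<delta> > 0" for \<delta> c
    using fam[OF that] by auto
  have dV: "(V \<delta> c has_real_derivative \<psi> (clamp_sym K (W \<delta> c (max a (t - \<delta>))) / \<rho> t)) (at t within {a..b})"
    and dW: "(W \<delta> c has_real_derivative \<rho> t * (s - G t (V \<delta> c (max a (t - \<delta>))))) (at t within {a..b})"
    if "\<delta> > 0" "t \<in> {a..b}" for \<delta> c t
    using fam[OF that(1)] that(2) by auto
  have lim: "\<exists>r v w. strict_mono (r :: nat \<Rightarrow> nat) \<and> uniform_limit {a..b} (\<lambda>k. V (\<delta> (r k)) (c (r k))) v sequentially \<and>
      (\<lambda>k. W (\<delta> (r k)) (c (r k)) b) \<longlonglongrightarrow> w b \<and> traj K s v w"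
    if "\<And>k. 0 < \<delta> k" "\<delta> \<longlonglongrightarrow> 0" "\<And>k. c k \<in> {-C..C}" for \<delta> c
  proof (rule limit_trajectory[where s = "\<lambda>_. s" and \<delta> = \<delta> and v = "\<lambda>k. V (\<delta> k) (c k)" and w = "\<lambda>k. W (\<delta> k) (c k)" and K = K and C = C])
    show "\<exists>t\<in>{a..b}. \<bar>V (\<delta> k) (c k) t\<bar> \<le> C" for k
      using that(1,3)[of k] ab by (intro bexI[of _ a]) (auto simp: Va)
    fix r v w assume "strict_mono r" "uniform_limit {a..b} (\<lambda>k. V (\<delta> (r k)) (c (r k))) v sequentially"
      "traj K s v w" and ulW: "uniform_limit {a..b} (\<lambda>k. W (\<delta> (r k)) (c (r k))) w sequentially"
    moreover have "(\<lambda>k. W (\<delta> (r k)) (c (r k)) b) \<longlonglongrightarrow> w b"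
      using tendsto_uniform_limitI[OF ulW] ab by auto
    ultimately show ?thesis by blast
  qed (use that in \<open>auto intro!: dV dW Wa less_imp_le\<close>)
  have tr_cont: "continuous_on {a..b} v" if "traj K s v w" for v w
    using that by (intro DERIV_continuous_on) (auto simp: traj_def)
  \<comment> \<open>\<open>bad \<delta> c\<close> contradicts \<open>far_trajectories\<close> or \<open>touching_trajectory\<close> in the limit \<open>\<delta> \<rightarrow> 0\<close>, so it cannot occur for small \<open>\<delta>\<close>.\<close>
  define bad where "bad \<delta> c \<longleftrightarrow> 0 \<le> W \<delta> c b \<and> \<bar>c\<bar> = C \<or> W \<delta> c b \<le> 0 \<and> (\<forall>t\<in>{a..b}. V \<delta> c t \<le> \<beta> t) \<and> (\<exists>t\<in>{a..b}. \<beta> t \<le> V \<delta> c t)" for \<delta> c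
  have "\<exists>n::nat. \<forall>c\<in>{-C..C}. \<forall>m\<ge>n. \<not> bad (1 / real (Suc m)) c"
  proof (rule ccontr)
    assume "\<not> ?thesis"
    then obtain m c where c: "\<And>n. c n \<in> {-C..C}" and m: "\<And>n. m n \<ge> n" and bad: "\<And>n. bad (1 / real (Suc (m n))) (c n)"
      by metis
    define \<delta> where "\<delta> n = 1 / real (Suc (m n))" for n
    have \<delta>: "\<delta> n > 0" for n by (simp add: \<delta>_def)
    have "\<delta> \<longlonglongrightarrow> 0"
    proof (rule Lim_null_comparison[OF _ LIMSEQ_inverse_real_of_nat])
      show "\<forall>\<^sub>F n in sequentially. norm (\<delta> n) \<le> inverse (real (Suc n))"
        using m by (intro always_eventually allI) (simp add: \<delta>_def field_simps)
    qed
    from lim[of \<delta> c, OF \<delta> this c] obtain r v w where r: "strict_mono r" and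
      ul: "uniform_limit {a..b} (\<lambda>k. V (\<delta> (r k)) (c (r k))) v sequentially" and
      Wl: "(\<lambda>k. W (\<delta> (r k)) (c (r k)) b) \<longlonglongrightarrow> w b" and tr: "traj K s v w" by blast
    have Vl: "(\<lambda>k. V (\<delta> (r k)) (c (r k)) t) \<longlonglongrightarrow> v t" if "t \<in> {a..b}" for t
      using tendsto_uniform_limitI[OF ul that] .
    have "bad (\<delta> n) (c n)" for n using bad by (simp add: \<delta>_def)
    show False
    \<comment> \<open>One of the two alternatives of \<open>bad\<close> persists along the sequence:
      the first infinitely often, or else the second from some index \<open>N\<close> on.\<close>
    proof (cases "\<exists>\<^sub>F k in sequentially. 0 \<le> W (\<delta> (r k)) (c (r k)) b \<and> \<bar>c (r k)\<bar> = C")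
      case True
      have "(\<lambda>k. c (r k)) \<longlonglongrightarrow> v a"
        using Vl[of a] ab by (simp add: Va[OF \<delta>])
      then have "(\<lambda>k. \<bar>c (r k)\<bar>) \<longlonglongrightarrow> \<bar>v a\<bar>" by (rule tendsto_rabs)
      have "w b \<ge> 0"
      proof (rule ccontr)
        assume "\<not> w b \<ge> 0"
        then have "\<forall>\<^sub>F k in sequentially. W (\<delta> (r k)) (c (r k)) b < 0"
          using order_tendstoD(2)[OF Wl] by simp
        then have "\<forall>\<^sub>F k in sequentially. \<not> (0 \<le> W (\<delta> (r k)) (c (r k)) b \<and> \<bar>c (r k)\<bar> = C)"
          by (rule eventually_mono) auto
        then show False using True by (simp add: frequently_def)
      qed
      moreover have "\<bar>v a\<bar> \<ge> C"
      proof (rule ccontr)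
        assume "\<not> \<bar>v a\<bar> \<ge> C"
        then have "\<forall>\<^sub>F k in sequentially. \<bar>c (r k)\<bar> < C"
          using order_tendstoD(2)[OF \<open>(\<lambda>k. \<bar>c (r k)\<bar>) \<longlonglongrightarrow> \<bar>v a\<bar>\<close>] by simp
        then have "\<forall>\<^sub>F k in sequentially. \<not> (0 \<le> W (\<delta> (r k)) (c (r k)) b \<and> \<bar>c (r k)\<bar> = C)"
          by (rule eventually_mono) auto
        then show False using True by (simp add: frequently_def)
      qed
      ultimately show False using D[OF tr] C by simp
    next
      case False
      then have "\<forall>\<^sub>F k in sequentially. \<not> (0 \<le> W (\<delta> (r k)) (c (r k)) b \<and> \<bar>c (r k)\<bar> = C)"
        by (simp add: frequently_def)
      then obtain N where N: "\<And>k. k \<ge> N \<Longrightarrow> \<not> (0 \<le> W (\<delta> (r k)) (c (r k)) b \<and> \<bar>c (r k)\<bar> = C)"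
        unfolding eventually_sequentially by blast
      define q where "q k = r (k + N)" for k
      have b2: "W (\<delta> (q k)) (c (q k)) b \<le> 0" "\<forall>t\<in>{a..b}. V (\<delta> (q k)) (c (q k)) t \<le> \<beta> t"
        "\<exists>t\<in>{a..b}. \<beta> t \<le> V (\<delta> (q k)) (c (q k)) t" for k
        using N[of "k + N"] \<open>\<And>n. bad (\<delta> n) (c n)\<close>[of "q k"] by (auto simp: bad_def q_def)
      have "w b \<le> 0"
        using LIMSEQ_ignore_initial_segment[OF Wl, of N] b2(1)
        by (intro LIMSEQ_le_const2[of "\<lambda>k. W (\<delta> (q k)) (c (q k)) b"]) (auto simp: q_def)
      moreover have vle: "v t \<le> \<beta> t" if "t \<in> {a..b}" for t
        using LIMSEQ_ignore_initial_segment[OF Vl[OF that], of N] b2(2) that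
        by (intro LIMSEQ_le_const2[of "\<lambda>k. V (\<delta> (q k)) (c (q k)) t"]) (auto simp: q_def)
      moreover have "uniform_limit {a..b} (\<lambda>k. V (\<delta> (q k)) (c (q k))) v sequentially"
        unfolding q_def using ul filterlim_add_const_nat_at_top[of N]
        by (rule filterlim_compose[of "\<lambda>k. V (\<delta> (r k)) (c (r k))"])
      from uniform_limit_touch[OF this tr_cont[OF tr] \<beta>c b2(3)]
      obtain t where "t \<in> {a..b}" "\<beta> t \<le> v t" by blast
      ultimately show False
        using touching_trajectory[OF tr up K(2) vle, of t] by (force intro: antisym)
    qed
  qed
  then obtain n0 :: nat where n0: "\<And>c m. \<lbrakk>c \<in> {-C..C}; n0 \<le> m\<rbrakk> \<Longrightarrow> \<not> bad (1 / real (Suc m)) c" by blast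
  \<comment> \<open>The shift by \<open>n0\<close> makes every delay in the sequence small enough to
    exclude \<open>bad\<close>.\<close>
  define \<delta> where "\<delta> n = 1 / real (Suc (n + n0))" for n
  have \<delta>: "\<delta> n > 0" for n by (simp add: \<delta>_def)
  have \<delta>l: "\<delta> \<longlonglongrightarrow> 0"
    unfolding \<delta>_def using LIMSEQ_ignore_initial_segment[OF LIMSEQ_inverse_real_of_nat, of n0]
    by (simp add: inverse_eq_divide)
  have good: "\<not> bad (\<delta> n) c" if "c \<in> {-C..C}" for n c
    using n0[OF that, of "n + n0"] by (simp add: \<delta>_def)
  have "(\<exists>c\<in>{-C..C}. W (\<delta> n) c b = 0 \<and> (\<forall>t\<in>{a..b}. V (\<delta> n) c t \<le> \<beta> t)) \<and>
         (\<exists>c\<in>{-C..C}. W (\<delta> n) c b = 0 \<and> (\<exists>t\<in>{a..b}. \<beta> t \<le> V (\<delta> n) c t))" for n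
  proof (rule crossing_parameters)
    show "continuous_on UNIV (\<lambda>c. W (\<delta> n) c b)"
      using continuous_on_compose2[OF Wc[OF \<delta>, of n] continuous_on_Pair[OF continuous_on_id continuous_on_const], of b UNIV] ab
      by (auto simp: image_subset_iff)
    show "V (\<delta> n) (- C) t < \<beta> t" if t: "t \<in> {a..b}" for t
    proof -
      have "norm (V (\<delta> n) (- C) t - V (\<delta> n) (- C) a) \<le> M * \<bar>t - a\<bar>"
        using dV[OF \<delta>[of n]] M t by (intro norm_vector_derivative_bound[where a = a and b = b
          and x' = "\<lambda>t. \<psi> (clamp_sym K (W (\<delta> n) (- C) (max a (t - \<delta> n))) / \<rho> t)"])
          (auto simp: has_real_derivative_iff_has_vector_derivative)
      also have "\<dots> \<le> M * (b - a)" using t M by (intro mult_left_mono) auto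
      finally show ?thesis using C B\<beta>[OF t] by (simp add: Va[OF \<delta>] abs_le_iff)
    qed
    show "\<beta> a < V (\<delta> n) C a" using C Mab B\<beta>[of a] ab by (simp add: Va[OF \<delta>] abs_le_iff)
    show "W (\<delta> n) (- C) b < 0" "W (\<delta> n) C b < 0"
      using good[of C n] good[of "- C" n] C by (auto simp: bad_def)
    fix c r assume "c \<in> {-C..C}" "r \<in> {a..b}" "V (\<delta> n) c r = \<beta> r" "\<And>t. t \<in> {a..b} \<Longrightarrow> V (\<delta> n) c t \<le> \<beta> t"
    then show "W (\<delta> n) c b > 0"
      using good[of c n] by (force simp: bad_def)
  qed (use ab \<beta>c C Vc[OF \<delta>] in auto)
  then obtain c1 c2 where c1: "\<And>n. c1 n \<in> {-C..C}" "\<And>n. W (\<delta> n) (c1 n) b = 0"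
      "\<And>n t. t \<in> {a..b} \<Longrightarrow> V (\<delta> n) (c1 n) t \<le> \<beta> t"
    and c2: "\<And>n. c2 n \<in> {-C..C}" "\<And>n. W (\<delta> n) (c2 n) b = 0" "\<And>n. \<exists>t\<in>{a..b}. \<beta> t \<le> V (\<delta> n) (c2 n) t"
    by metis
  obtain r1 v1 w1 where 1: "strict_mono (r1 :: nat \<Rightarrow> nat)"
      "uniform_limit {a..b} (\<lambda>k. V (\<delta> (r1 k)) (c1 (r1 k))) v1 sequentially" "w1 b = 0" "traj K s v1 w1"
    using lim[of \<delta> c1, OF \<delta> \<delta>l c1(1)] by (auto simp: c1(2) LIMSEQ_const_iff)
  obtain r2 v2 w2 where 2: "strict_mono (r2 :: nat \<Rightarrow> nat)"
      "uniform_limit {a..b} (\<lambda>k. V (\<delta> (r2 k)) (c2 (r2 k))) v2 sequentially" "w2 b = 0" "traj K s v2 w2"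
    using lim[of \<delta> c2, OF \<delta> \<delta>l c2(1)] by (auto simp: c2(2) LIMSEQ_const_iff)
  have v1: "v1 t \<le> \<beta> t" if "t \<in> {a..b}" for t
    using tendsto_uniform_limitI[OF 1(2) that] c1(3)[OF that] by (intro LIMSEQ_le_const2) auto
  \<comment> \<open>Contact would make \<open>w1 b\<close> positive, but it is 0.\<close>
  have v1_lt: "v1 t < \<beta> t" if "t \<in> {a..b}" for t
    using touching_trajectory[OF 1(4) up K(2) v1 that] v1[OF that] 1(3) by (cases "v1 t = \<beta> t") auto
  obtain t where t: "t \<in> {a..b}" "\<beta> t \<le> v2 t"
    using uniform_limit_touch[OF 2(2) tr_cont[OF 2(4)] \<beta>c c2(3)] by blast
  have "v1 t \<noteq> v2 t" using t v1_lt[of t] by auto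
  then show ?thesis
    using traj_imp_sol[OF 1(4,3) K(1)] traj_imp_sol[OF 2(4,3) K(1)] t by blast
qed

text \<open>The threshold is the infimum of the solvable levels. It is attained by closedness, and
  the solution found there is a strict upper solution at every larger level.\<close>

theorem threshold:
  "\<exists>s0. (\<forall>s<s0. \<not> (\<exists>v w. sol s v w)) \<and> (\<exists>v w. sol s0 v w) \<and>
    (\<forall>s>s0. \<exists>v1 w1 v2 w2. sol s v1 w1 \<and> sol s v2 w2 \<and> (\<exists>t\<in>{a..b}. v1 t \<noteq> v2 t))"
proof -
  define S where "S = {s. \<exists>v w. sol s v w}"
  obtain u0 g0 where u0: "\<And>t. t \<in> {a..b} \<Longrightarrow> G t u0 \<le> g0" using G_const by blast
  have "strict_upper (g0 + 1) (\<lambda>_. u0) (\<lambda>_. 0)"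
    using u0 by (intro const_strict_upper) force
  from two_solutions[OF this] have ne: "S \<noteq> {}" by (auto simp: S_def)
  have bdd: "bdd_below S" using sol_ge by (intro bdd_belowI[of _ "- C0"]) (auto simp: S_def)
  have "Inf S \<in> closure S" using ne bdd by (rule closure_contains_Inf)
  then obtain s where "\<And>k. s k \<in> S" "s \<longlonglongrightarrow> Inf S" unfolding closure_sequential by blast
  moreover from this(1) obtain v w where "\<And>k. sol (s k) (v k) (w k)" unfolding S_def mem_Collect_eq by metis
  ultimately have at_inf: "\<exists>v w. sol (Inf S) v w" using solvable_closed by blast
  show ?thesis
  proof (intro exI[of _ "Inf S"] conjI allI impI at_inf)
    fix s assume "s < Inf S"
    then show "\<not> (\<exists>v w. sol s v w)" using cInf_lower[OF _ bdd, of s] by (auto simp: S_def)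
  next
    fix s assume "Inf S < s"
    then show "\<exists>v1 w1 v2 w2. sol s v1 w1 \<and> sol s v2 w2 \<and> (\<exists>t\<in>{a..b}. v1 t \<noteq> v2 t)"
      using at_inf sol_strict_upper two_solutions by blast
  qed
qed

end

section \<open>Integration over annuli\<close>

lemma closed_annulus_eq: "(closed_annulus r R :: (real^'n) set) = cball 0 R - ball 0 r"
  by (auto simp: closed_annulus_def)

lemma compact_closed_annulus: "compact (closed_annulus r R :: (real^'n) set)"
  unfolding closed_annulus_eq by (intro compact_diff compact_cball open_ball)

lemma annulus_subset_closed: "annulus r R \<subseteq> closed_annulus r R"
  by (auto simp: annulus_def closed_annulus_def)

lemma open_annulus: "open (annulus r R)"
  unfolding annulus_def by (intro open_Collect_conj open_Collect_less continuous_intros)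

lemma bounded_annulus: "bounded (annulus r R)"
  by (rule bounded_subset[OF bounded_cball[of 0 R]]) (auto simp: annulus_def)

lemma integrable_on_closed_annulus:
  fixes F :: "real^'n \<Rightarrow> real"
  assumes "continuous_on (closed_annulus r R) F"
  shows "F integrable_on closed_annulus r R"
  using borel_integrable_compact[OF compact_closed_annulus assms]
  by (intro set_borel_integral_eq_integral) (simp add: set_integrable_def)

lemma negligible_sphere_zero: "negligible (sphere 0 r :: (real^'n) set)"
  using negligible_convex_frontier[of "cball (0::real^'n) r"] by (cases "r < 0") auto

lemma integral_closed_annulus_combine:
  fixes F :: "real^'n \<Rightarrow> real"
  assumes F: "continuous_on (closed_annulus a r') F" and r: "a \<le> r" "r \<le> r'"
  shows "integral (closed_annulus a r') F = integral (closed_annulus a r) F + integral (closed_annulus r r') F"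
proof -
  have eq: "closed_annulus a r' = closed_annulus a r \<union> closed_annulus r r'"
    using r by (auto simp: closed_annulus_def)
  have "closed_annulus a r \<inter> closed_annulus r r' \<subseteq> (sphere 0 r :: (real^'n) set)"
    by (auto simp: closed_annulus_def)
  moreover note negligible_sphere_zero[of r, where 'n = 'n]
  ultimately have "negligible (closed_annulus a r \<inter> closed_annulus r r' :: (real^'n) set)"
    using negligible_subset by blast
  then show ?thesis
    using F unfolding eq by (intro integral_Un integrable_on_closed_annulus) (auto elim: continuous_on_subset)
qed

lemma integral_closed_annulus_const:
  assumes r: "0 \<le> r" "r \<le> r'"
  shows "integral (closed_annulus r r' :: (real^'n) set) (\<lambda>_. c) =
    c * (measure lborel (ball (0::real^'n) 1) * (r' ^ CARD('n) - r ^ CARD('n)))"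
proof -
  have meas: "measure lborel (cball (0::real^'n) s) = measure lborel (ball (0::real^'n) 1) * s ^ CARD('n)" if "s \<ge> 0" for s
    using that content_ball_conv_unit_ball[of s "0::real^'n"] by (simp add: content_cball_conv_ball mult.commute)
  have b: "ball (0::real^'n) r \<subseteq> cball 0 r'" using r by (auto simp: subset_iff)
  have "closed_annulus r r' = cball (0::real^'n) r' - ball 0 r" by (rule closed_annulus_eq)
  then have "measure lebesgue (closed_annulus r r' :: (real^'n) set) = measure lebesgue (cball (0::real^'n) r') - measure lebesgue (ball (0::real^'n) r)"
    using b by (simp add: measurable_measure_Diff)
  also have "measure lebesgue (ball (0::real^'n) r) = measure lebesgue (cball (0::real^'n) r)"
    by (simp add: content_cball_conv_ball)
  finally have m: "measure lebesgue (closed_annulus r r' :: (real^'n) set) = measure lborel (ball (0::real^'n) 1) * (r' ^ CARD('n) - r ^ CARD('n))"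
    using r by (simp add: meas right_diff_distrib)
  have "(closed_annulus r r' :: (real^'n) set) \<in> lmeasurable"
    using compact_closed_annulus by (rule lmeasurable_compact)
  from lmeasure_integral[OF this] m
  have "integral (closed_annulus r r' :: (real^'n) set) (\<lambda>_. 1) = measure lborel (ball (0::real^'n) 1) * (r' ^ CARD('n) - r ^ CARD('n))"
    by simp
  then show ?thesis
    using integral_mult_right[of "closed_annulus r r' :: (real^'n) set" c "\<lambda>_. 1"] by simp
qed

lemma continuous_on_radial:
  assumes f: "continuous_on {a..b} f" and S: "S \<subseteq> closed_annulus a b"
  shows "continuous_on S (\<lambda>x. f (norm x))"
  using S by (intro continuous_on_compose2[OF f] continuous_intros) (auto simp: closed_annulus_def)

text \<open>On the shell the function is compared with the constant \<open>c\<close>, whose integral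
  is explicit. The error is measured against the volume of the shell.\<close>

lemma shell_estimate:
  fixes f :: "real \<Rightarrow> real"
  assumes f: "continuous_on {a..b} f" and a: "0 \<le> a" and r: "a \<le> r" "r \<le> r'" "r' \<le> b"
    and e: "\<And>t. t \<in> {r..r'} \<Longrightarrow> \<bar>f t - c\<bar> \<le> e"
  shows "\<bar>integral (closed_annulus a r' :: (real^'n) set) (\<lambda>x. f (norm x)) - integral (closed_annulus a r :: (real^'n) set) (\<lambda>x. f (norm x)) -
      c * (measure lborel (ball (0::real^'n) 1) * (r' ^ CARD('n) - r ^ CARD('n)))\<bar>
    \<le> e * (measure lborel (ball (0::real^'n) 1) * (r' ^ CARD('n) - r ^ CARD('n)))"
proof -
  let ?A = "closed_annulus r r' :: (real^'n) set"
  have sub: "?A \<subseteq> closed_annulus a b" "(closed_annulus a r' :: (real^'n) set) \<subseteq> closed_annulus a b"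
    using r by (auto simp: closed_annulus_def)
  note int = integrable_on_closed_annulus[OF continuous_on_radial[OF f sub(1)]]
    integrable_on_closed_annulus[OF continuous_on_const]
  have "integral (closed_annulus a r' :: (real^'n) set) (\<lambda>x. f (norm x)) - integral (closed_annulus a r :: (real^'n) set) (\<lambda>x. f (norm x)) -
      c * (measure lborel (ball (0::real^'n) 1) * (r' ^ CARD('n) - r ^ CARD('n))) = integral ?A (\<lambda>x. f (norm x) - c)"
    using integral_closed_annulus_combine[OF continuous_on_radial[OF f sub(2)] r(1,2)]
      integral_closed_annulus_const[of r r' c, where 'n = 'n] r a integral_diff[OF int]
    by simp
  moreover have "norm (integral ?A (\<lambda>x. f (norm x) - c)) \<le> integral ?A (\<lambda>_. e)"
    using e by (intro integral_norm_bound_integral integrable_diff int) (auto simp: closed_annulus_def)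
  ultimately show ?thesis
    using integral_closed_annulus_const[of r r' e, where 'n = 'n] r a by simp
qed

text \<open>Used with \<open>P\<close> the volume of a ball, so that estimates on thin shells relative to their volume suffice.\<close>

lemma relative_derivative:
  fixes \<Phi> P :: "real \<Rightarrow> real"
  assumes P: "(P has_real_derivative P') (at r within S)"
    and \<Phi>: "\<And>e. e > 0 \<Longrightarrow> \<exists>d>0. \<forall>y\<in>S. \<bar>y - r\<bar> < d \<longrightarrow> \<bar>\<Phi> y - \<Phi> r - c * (P y - P r)\<bar> \<le> e * \<bar>P y - P r\<bar>"
  shows "(\<Phi> has_real_derivative c * P') (at r within S)"
proof -
  \<comment> \<open>The difference quotient of \<open>\<Phi>\<close> with respect to
    \<open>P\<close>, given the value \<open>c\<close> where it is undefined, so that the quotient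
    of \<open>\<Phi>\<close> factors as \<open>q\<close> times the quotient of
    \<open>P\<close>.\<close>
  define q where "q y = (if P y = P r then c else (\<Phi> y - \<Phi> r) / (P y - P r))" for y
  have "(q \<longlongrightarrow> c) (at r within S)"
    unfolding tendsto_iff eventually_at
  proof (intro allI impI)
    fix e :: real assume e: "e > 0"
    then obtain d where d: "d > 0" "\<And>y. \<lbrakk>y \<in> S; \<bar>y - r\<bar> < d\<rbrakk> \<Longrightarrow> \<bar>\<Phi> y - \<Phi> r - c * (P y - P r)\<bar> \<le> (e / 2) * \<bar>P y - P r\<bar>"
      using \<Phi>[of "e / 2"] by auto
    have "dist (q y) c < e" if y: "y \<in> S" "dist y r < d" for y
    proof (cases "P y = P r")
      case False
      have "q y - c = (\<Phi> y - \<Phi> r - c * (P y - P r)) / (P y - P r)"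
        using False by (simp add: q_def field_simps)
      then have "\<bar>q y - c\<bar> = \<bar>\<Phi> y - \<Phi> r - c * (P y - P r)\<bar> / \<bar>P y - P r\<bar>"
        by (simp add: abs_divide)
      also have "\<dots> \<le> e / 2"
        using d(2)[of y] y False by (simp add: pos_divide_le_eq dist_real_def)
      finally show ?thesis using e by (simp add: dist_real_def)
    qed (use e in \<open>simp add: q_def\<close>)
    then show "\<exists>d>0. \<forall>y\<in>S. y \<noteq> r \<and> dist y r < d \<longrightarrow> dist (q y) c < e"
      using d(1) by blast
  qed
  from tendsto_mult[OF this P[unfolded has_field_derivative_iff]]
  have "((\<lambda>y. q y * ((P y - P r) / (y - r))) \<longlongrightarrow> c * P') (at r within S)" .
  moreover have "\<forall>\<^sub>F y in at r within S. q y * ((P y - P r) / (y - r)) = (\<Phi> y - \<Phi> r) / (y - r)"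
  proof -
    \<comment> \<open>Any fixed constant would do: the estimate forces
      \<open>\<Phi> y = \<Phi> r\<close> wherever \<open>P y = P r\<close>, so the factorisation
      holds there too.\<close>
    obtain d where d: "d > 0" "\<And>y. \<lbrakk>y \<in> S; \<bar>y - r\<bar> < d\<rbrakk> \<Longrightarrow> \<bar>\<Phi> y - \<Phi> r - c * (P y - P r)\<bar> \<le> 1 * \<bar>P y - P r\<bar>"
      using \<Phi>[of 1] by auto
    have "q y * ((P y - P r) / (y - r)) = (\<Phi> y - \<Phi> r) / (y - r)" if "y \<in> S" "dist y r < d" for y
      using d(2)[of y] that by (cases "P y = P r") (auto simp: q_def dist_real_def)
    then show ?thesis using d(1) by (auto simp: eventually_at)
  qed
  ultimately show ?thesis
    unfolding has_field_derivative_iff by (rule Lim_transform_eventually)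
qed

text \<open>Polar coordinates for radial integrands. As a function of the outer radius the integral
  is differentiable by comparison with the volume of the ball, and the fundamental theorem of
  calculus integrates the derivative.\<close>

lemma integral_radial_closed_annulus:
  fixes f :: "real \<Rightarrow> real"
  assumes a: "0 \<le> a" "a \<le> b" and f: "continuous_on {a..b} f"
  shows "integral (closed_annulus a b :: (real^'n) set) (\<lambda>x. f (norm x)) =
    real CARD('n) * measure lborel (ball (0::real^'n) 1) * integral {a..b} (\<lambda>r. r ^ (CARD('n) - 1) * f r)"
proof -
  define \<kappa> where "\<kappa> = measure lborel (ball (0::real^'n) 1)"
  define P where "P r = \<kappa> * r ^ CARD('n)" for r :: real
  define \<Phi> where "\<Phi> r = integral (closed_annulus a r :: (real^'n) set) (\<lambda>x. f (norm x))" for r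
  have \<kappa>: "\<kappa> \<ge> 0" by (simp add: \<kappa>_def)
  have est: "\<bar>\<Phi> y - \<Phi> r - c * (P y - P r)\<bar> \<le> e * \<bar>P y - P r\<bar>"
    if r: "r \<in> {a..b}" "y \<in> {a..b}" and e: "\<And>t. \<lbrakk>t \<in> {a..b}; \<bar>t - r\<bar> \<le> \<bar>y - r\<bar>\<rbrakk> \<Longrightarrow> \<bar>f t - c\<bar> \<le> e" for r y c e
  proof (cases "r \<le> y")
    case True
    then have "P r \<le> P y" using r a \<kappa> by (auto simp: P_def intro!: mult_left_mono power_mono)
    moreover have "\<bar>\<Phi> y - \<Phi> r - c * (\<kappa> * (y ^ CARD('n) - r ^ CARD('n)))\<bar> \<le> e * (\<kappa> * (y ^ CARD('n) - r ^ CARD('n)))"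
      unfolding \<Phi>_def \<kappa>_def using True r a e by (intro shell_estimate[OF f]) auto
    ultimately show ?thesis by (simp add: P_def right_diff_distrib)
  next
    case False
    then have "P y \<le> P r" using r a \<kappa> by (auto simp: P_def intro!: mult_left_mono power_mono)
    moreover have "\<bar>\<Phi> r - \<Phi> y - c * (\<kappa> * (r ^ CARD('n) - y ^ CARD('n)))\<bar> \<le> e * (\<kappa> * (r ^ CARD('n) - y ^ CARD('n)))"
      unfolding \<Phi>_def \<kappa>_def using False r a e by (intro shell_estimate[OF f]) auto
    moreover have "\<Phi> y - \<Phi> r - c * (P y - P r) = - (\<Phi> r - \<Phi> y - c * (\<kappa> * (r ^ CARD('n) - y ^ CARD('n))))"
      by (simp add: P_def algebra_simps)
    ultimately show ?thesis by (simp add: P_def right_diff_distrib del: minus_diff_eq)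
  qed
  have "(\<Phi> has_real_derivative f r * (\<kappa> * (real CARD('n) * r ^ (CARD('n) - 1)))) (at r within {a..b})"
    if r: "r \<in> {a..b}" for r
  proof (rule relative_derivative[where P = P])
    show "(P has_real_derivative \<kappa> * (real CARD('n) * r ^ (CARD('n) - 1))) (at r within {a..b})"
      unfolding P_def by (auto intro!: derivative_eq_intros)
    fix e :: real assume e: "e > 0"
    then obtain d where d: "d > 0" "\<And>t. \<lbrakk>t \<in> {a..b}; dist t r < d\<rbrakk> \<Longrightarrow> dist (f t) (f r) < e"
      using f r unfolding continuous_on_iff by blast
    show "\<exists>d>0. \<forall>y\<in>{a..b}. \<bar>y - r\<bar> < d \<longrightarrow> \<bar>\<Phi> y - \<Phi> r - f r * (P y - P r)\<bar> \<le> e * \<bar>P y - P r\<bar>"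
    proof (intro exI conjI ballI impI)
      fix y assume y: "y \<in> {a..b}" "\<bar>y - r\<bar> < d"
      show "\<bar>\<Phi> y - \<Phi> r - f r * (P y - P r)\<bar> \<le> e * \<bar>P y - P r\<bar>"
        using d(2) y by (intro est r) (force simp: dist_real_def)+
    qed (rule d(1))
  qed
  then have "((\<lambda>r. f r * (\<kappa> * (real CARD('n) * r ^ (CARD('n) - 1)))) has_integral (\<Phi> b - \<Phi> a)) {a..b}"
    using a by (intro fundamental_theorem_of_calculus) (auto simp: has_real_derivative_iff_has_vector_derivative)
  moreover have "\<Phi> a = 0"
  proof -
    have "integral (closed_annulus a a :: (real^'n) set) (\<lambda>x. f (norm x)) = integral (closed_annulus a a :: (real^'n) set) (\<lambda>x. f a)"
      by (rule integral_cong) (auto simp: closed_annulus_def intro: arg_cong[where f = f])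
    then show ?thesis using a by (simp add: \<Phi>_def integral_closed_annulus_const)
  qed
  ultimately have "integral {a..b} (\<lambda>r. f r * (\<kappa> * (real CARD('n) * r ^ (CARD('n) - 1)))) = \<Phi> b"
    by (simp add: integral_unique)
  moreover have "(\<lambda>r. f r * (\<kappa> * (real CARD('n) * r ^ (CARD('n) - 1)))) = (\<lambda>r. (real CARD('n) * \<kappa>) * (r ^ (CARD('n) - 1) * f r))"
    by (auto simp: mult_ac)
  ultimately show ?thesis by (simp add: \<Phi>_def \<kappa>_def)
qed

lemma integral_annulus_eq_closed:
  fixes F :: "real^'n \<Rightarrow> real"
  shows "integral (annulus a b) F = integral (closed_annulus a b) F"
proof -
  have n: "negligible (sphere 0 a \<union> sphere 0 b :: (real^'n) set)"
    by (simp add: negligible_Un negligible_sphere_zero)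
  show ?thesis
    by (intro integral_spike_set; rule negligible_subset[OF n]) (auto simp: annulus_def closed_annulus_def)
qed

text \<open>The factor coming from the unit ball appears in both the integral and the volume of the
  annulus and cancels.\<close>

lemma avgG_radial:
  assumes a: "0 < a" "a < b" and f: "continuous_on {a..b} (\<lambda>t. G t (v t))"
  shows "avgG G a b (\<lambda>x::real^'n. v (norm x)) =
    integral {a..b} (\<lambda>t. t ^ (CARD('n) - 1) * G t (v t)) / integral {a..b} (\<lambda>t. t ^ (CARD('n) - 1))"
proof -
  have "(annulus a b :: (real^'n) set) \<in> lmeasurable"
    using open_annulus bounded_annulus by (rule lmeasurable_open[rotated])
  then have "measure lebesgue (annulus a b :: (real^'n) set) = integral (closed_annulus a b :: (real^'n) set) (\<lambda>_. 1)"
    by (simp add: lmeasure_integral integral_annulus_eq_closed)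
  also have "\<dots> = real CARD('n) * measure lborel (ball (0::real^'n) 1) * integral {a..b} (\<lambda>t. t ^ (CARD('n) - 1))"
    using integral_radial_closed_annulus[of a b "\<lambda>_. 1", where 'n = 'n] a by simp
  finally have "measure lebesgue (annulus a b :: (real^'n) set) =
    real CARD('n) * measure lborel (ball (0::real^'n) 1) * integral {a..b} (\<lambda>t. t ^ (CARD('n) - 1))" .
  moreover have "measure lborel (ball (0::real^'n) 1) > 0" by (rule content_ball_pos) simp
  ultimately show ?thesis
    using integral_radial_closed_annulus[OF _ _ f, where 'n = 'n] a
    by (simp add: avgG_def integral_annulus_eq_closed)
qed

section \<open>Radial fields\<close>

text \<open>The sets \<open>S\<close> and \<open>T\<close> admit one-sided derivatives in the
  radius, as needed on the boundary of the closed annulus.\<close>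

lemma has_derivative_radial:
  fixes x :: "real^'n"
  assumes v: "(v has_real_derivative D) (at (norm x) within T)" and x: "x \<noteq> 0" and S: "norm ` S \<subseteq> T"
  shows "((\<lambda>y. v (norm y)) has_derivative (\<lambda>h. ((D / norm x) *\<^sub>R x) \<bullet> h)) (at x within S)"
proof -
  have "(norm has_derivative (\<lambda>h. h \<bullet> sgn x)) (at x within S)"
    by (rule has_derivative_at_withinI[OF has_derivative_norm[OF x]])
  moreover have "(v has_derivative (*) D) (at (norm x) within norm ` S)"
    using v S unfolding has_field_derivative_def by (rule has_derivative_subset)
  ultimately have "((\<lambda>y. v (norm y)) has_derivative (\<lambda>h. D * (h \<bullet> sgn x))) (at x within S)"
    by (rule has_derivative_in_compose)
  then show ?thesis by (simp add: sgn_div_norm inner_commute divide_inverse mult.assoc)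
qed

text \<open>Here \<open>N\<close> is the norm of a point, \<open>k\<close> the dimension and
  \<open>p\<close> the power of \<open>N\<close> with exponent \<open>k - 1\<close>. Naming the
  power keeps symbolic exponents out of the field arithmetic.\<close>

lemma flux_quotient:
  fixes p N :: real
  assumes "N \<noteq> 0" "p \<noteq> 0"
  shows "(D * (p * N) - W * (k * p)) / (p * N * (p * N)) = D / (p * N) - k * W / (p * N * N)"
    and flux_quotient_div: "(D / (p * N) - k * W / (p * N * N)) / N = D / (p * N * N) - k * W / (p * N * N * N)"
    and flux_trace: "k * (W / (p * N)) + (D / (p * N * N) - k * W / (p * N * N * N)) * (N * N) = D / p"
  using assms by (simp_all add: field_simps)

text \<open>The field has radial component \<open>w (norm y) / norm y ^ (CARD('n) - 1)\<close>. The
  product rule gives a multiple of the identity plus a rank-one part along \<open>x\<close>.\<close>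

lemma radial_flux_derivative:
  fixes x :: "real^'n"
  assumes w: "(w has_real_derivative D) (at (norm x))" and x: "x \<noteq> 0"
  shows "((\<lambda>y. (w (norm y) / norm y ^ CARD('n)) *\<^sub>R y) has_derivative
    (\<lambda>h. (w (norm x) / norm x ^ CARD('n)) *\<^sub>R h +
      ((D / norm x ^ (CARD('n) + 1) - real CARD('n) * w (norm x) / norm x ^ (CARD('n) + 2)) * (x \<bullet> h)) *\<^sub>R x)) (at x)"
proof -
  define m where "m = CARD('n) - 1"
  define N where "N = norm x"
  define p where "p = N ^ m"
  have n: "CARD('n) = Suc m" by (simp add: m_def)
  have pw: "N ^ Suc m = p * N" "N ^ (Suc m + 1) = p * N * N" "N ^ (Suc m + 2) = p * N * N * N"
    by (simp_all add: p_def mult_ac)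
  have N: "N \<noteq> 0" "p \<noteq> 0" using x by (simp_all add: N_def p_def)
  have "((\<lambda>t. w t / t ^ Suc m) has_real_derivative
      (D * N ^ Suc m - w N * (real (Suc m) * N ^ m)) / (N ^ Suc m * N ^ Suc m)) (at N)"
    using w N DERIV_pow[of "Suc m" N UNIV] unfolding N_def by (intro DERIV_divide) simp_all
  then have "((\<lambda>t. w t / t ^ Suc m) has_real_derivative D / (p * N) - real (Suc m) * w N / (p * N * N)) (at N)"
    unfolding pw p_def[symmetric] by (simp only: flux_quotient[OF N])
  then have "((\<lambda>y. w (norm y) / norm y ^ Suc m) has_derivative
      (\<lambda>h. (((D / (p * N) - real (Suc m) * w N / (p * N * N)) / norm x) *\<^sub>R x) \<bullet> h)) (at x)"
    using x unfolding N_def by (intro has_derivative_radial[where T = UNIV]) auto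
  from has_derivative_scaleR[OF this has_derivative_ident]
  show ?thesis
    unfolding n N_def[symmetric] pw using N by (simp add: flux_quotient_div del: of_nat_Suc)
qed

text \<open>In the trace the terms containing \<open>w\<close> itself cancel and only its derivative
  remains. This is why the weighted flux is the natural second unknown.\<close>

lemma divergence_radial_flux:
  fixes x :: "real^'n"
  assumes w: "(w has_real_derivative D) (at (norm x))" and x: "x \<noteq> 0"
    and S: "open S" "x \<in> S" and F: "\<And>y. y \<in> S \<Longrightarrow> F y = (w (norm y) / norm y ^ CARD('n)) *\<^sub>R y"
  shows "divergence F x = D / norm x ^ (CARD('n) - 1)"
proof -
  define \<alpha> where "\<alpha> = w (norm x) / norm x ^ CARD('n)"
  define \<gamma> where "\<gamma> = D / norm x ^ (CARD('n) + 1) - real CARD('n) * w (norm x) / norm x ^ (CARD('n) + 2)"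
  have r: "norm x \<noteq> 0" using x by simp
  have "(F has_derivative (\<lambda>h. \<alpha> *\<^sub>R h + (\<gamma> * (x \<bullet> h)) *\<^sub>R x)) (at x)"
    unfolding \<alpha>_def \<gamma>_def
    by (rule has_derivative_transform_within_open[OF radial_flux_derivative[OF w x] S]) (simp add: F)
  then have "frechet_derivative F (at x) = (\<lambda>h. \<alpha> *\<^sub>R h + (\<gamma> * (x \<bullet> h)) *\<^sub>R x)"
    by (rule frechet_derivative_at[symmetric])
  then have "divergence F x = (\<Sum>i\<in>UNIV. \<alpha> + \<gamma> * (x $ i * x $ i))"
    by (simp add: divergence_def inner_axis mult.assoc)
  also have "\<dots> = real CARD('n) * \<alpha> + \<gamma> * (x \<bullet> x)"
    by (simp add: sum.distrib inner_vec_def sum_distrib_left)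
  also have "x \<bullet> x = norm x ^ 2" by (simp add: power2_norm_eq_inner)
  also have "real CARD('n) * \<alpha> + \<gamma> * norm x ^ 2 = D / norm x ^ (CARD('n) - 1)"
  proof -
    define m where "m = CARD('n) - 1"
    define N where "N = norm x"
    define p where "p = N ^ m"
    have n: "CARD('n) = Suc m" by (simp add: m_def)
    have pw: "N ^ Suc m = p * N" "N ^ (Suc m + 1) = p * N * N" "N ^ (Suc m + 2) = p * N * N * N" "N ^ (Suc m - 1) = p" "N ^ 2 = N * N"
      by (simp_all add: p_def mult_ac power2_eq_square)
    have N: "N \<noteq> 0" "p \<noteq> 0" using x by (simp_all add: N_def p_def)
    show ?thesis
      unfolding \<alpha>_def \<gamma>_def n N_def[symmetric] pw using N by (rule flux_trace)
  qed
  finally show ?thesis .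
qed

lemma C1_field_on_radial_flux:
  fixes F :: "real^'n \<Rightarrow> real^'n"
  assumes a: "0 < a"
    and w: "\<And>t. t \<in> {a<..<b} \<Longrightarrow> (w has_real_derivative w' t) (at t)"
    and w': "continuous_on {a<..<b} w'"
    and F: "\<And>y. y \<in> annulus a b \<Longrightarrow> F y = (w (norm y) / norm y ^ CARD('n)) *\<^sub>R y"
  shows "C1_field_on (annulus a b) F"
proof -
  let ?F' = "\<lambda>x h. (w (norm x) / norm x ^ CARD('n)) *\<^sub>R h +
      ((w' (norm x) / norm x ^ (CARD('n) + 1) - real CARD('n) * w (norm x) / norm x ^ (CARD('n) + 2)) * (x \<bullet> h)) *\<^sub>R x"
  have d: "(F has_derivative ?F' x) (at x)" if x: "x \<in> annulus a b" for x
  proof -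
    have "x \<noteq> 0" "norm x \<in> {a<..<b}" using x a by (auto simp: annulus_def)
    from radial_flux_derivative[OF w[OF this(2)] this(1)]
    show ?thesis by (rule has_derivative_transform_within_open[OF _ open_annulus x]) (simp add: F)
  qed
  have eq: "frechet_derivative F (at x) = ?F' x" if "x \<in> annulus a b" for x
    by (rule frechet_derivative_at[OF d[OF that], symmetric])
  have wc: "continuous_on {a<..<b} w"
    using has_field_derivative_at_within[OF w] by (rule DERIV_continuous_on)
  have "continuous_on (annulus a b) (\<lambda>x. frechet_derivative F (at x) h)" for h
  proof (rule continuous_on_eq)
    show "continuous_on (annulus a b) (\<lambda>x. ?F' x h)"
      using a by (intro continuous_intros continuous_on_compose2[OF wc] continuous_on_compose2[OF w'])
        (auto simp: annulus_def)
  qed (simp add: eq)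
  then show ?thesis
    using d by (auto simp: C1_field_on_def differentiable_def)
qed

lemma C1_radial:
  fixes v :: "real \<Rightarrow> real"
  assumes a: "0 < a"
    and v: "\<And>t. t \<in> {a..b} \<Longrightarrow> (v has_real_derivative v' t) (at t within {a..b})"
    and v': "continuous_on {a..b} v'"
  shows "continuous_on (closed_annulus a b :: (real^'n) set) (\<lambda>x. (v' (norm x) / norm x) *\<^sub>R x)"
    and "\<And>x::real^'n. x \<in> closed_annulus a b \<Longrightarrow> ((\<lambda>y. v (norm y)) has_derivative
      (\<lambda>h. ((v' (norm x) / norm x) *\<^sub>R x) \<bullet> h)) (at x within closed_annulus a b)"
proof -
  show "continuous_on (closed_annulus a b :: (real^'n) set) (\<lambda>x. (v' (norm x) / norm x) *\<^sub>R x)"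
    using a by (intro continuous_intros continuous_on_compose2[OF v']) (auto simp: closed_annulus_def)
  fix x :: "real^'n" assume x: "x \<in> closed_annulus a b"
  then show "((\<lambda>y. v (norm y)) has_derivative
      (\<lambda>h. ((v' (norm x) / norm x) *\<^sub>R x) \<bullet> h)) (at x within closed_annulus a b)"
    using a by (intro has_derivative_radial[where T = "{a..b}"] v) (auto simp: closed_annulus_def)
qed

lemma phi1_sgn_cases:
  assumes A: "\<forall>t>0. A t > 0"
  shows "x > 0 \<Longrightarrow> phi1 A x > 0" "x < 0 \<Longrightarrow> phi1 A x < 0" "phi1 A 0 = 0" "phi1 A (- x) = - phi1 A x"
  using A by (auto simp: phi1_def mult_less_0_iff)

text \<open>A continuous injection is monotone on an interval; the signs of the values select the
  increasing case on the positive half-line, and oddness carries it to the negative one.\<close>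

lemma strict_mono_phi1:
  assumes A: "\<forall>t>0. A t > 0" and h: "homeomorphism UNIV UNIV (phi1 A) \<psi>"
  shows "strict_mono (phi1 A)"
proof (rule strict_monoI)
  note sg = phi1_sgn_cases[OF A]
  have cont: "continuous_on S (phi1 A)" for S
    using homeomorphism_cont1[OF h] by (rule continuous_on_subset) simp
  have inj: "inj (phi1 A)"
    using homeomorphism_apply1[OF h] by (metis UNIV_I injI)
  have pos: "phi1 A x < phi1 A y" if "0 < x" "x < y" for x y
    using continuous_inj_imp_mono[OF that cont inj_on_subset[OF inj]] sg(1)[of x] sg(3) that by auto
  fix x y :: real assume xy: "x < y"
  consider "0 < x" | "x = 0" | "x < 0" "y \<ge> 0" | "x < 0" "y < 0" by linarith
  then show "phi1 A x < phi1 A y"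
  proof cases
    case 4
    then show ?thesis using pos[of "- y" "- x"] xy sg(4)[of x] sg(4)[of y] by simp
  qed (use pos xy sg(1)[of y] sg(2)[of x] sg(3) in \<open>auto simp: order_le_less\<close>)
qed

section \<open>Equivalence of the Neumann problem and the radial system\<close>

lemma phiN_scaleR:
  fixes x :: "real^'n"
  assumes x: "x \<noteq> 0"
  shows "phiN A ((p / norm x) *\<^sub>R x) = (phi1 A p / norm x) *\<^sub>R x"
  using x by (auto simp: phiN_def phi1_def)

text \<open>Applying \<open>phiN\<close> to the radial gradient undoes \<open>\<psi>\<close> and
  leaves a field built from \<open>w\<close>, which is continuously differentiable even where the
  gradient need not be. Its divergence is given by \<open>divergence_radial_flux\<close>, and
  \<open>\<psi> 0 = 0\<close> makes the gradient vanish on the boundary.\<close>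

lemma radial_solution_of_ode:
  fixes v w :: "real \<Rightarrow> real"
  assumes a: "0 < a" "a < b" and h: "homeomorphism UNIV UNIV (phi1 A) \<psi>"
    and G: "continuous_on ({a..b} \<times> UNIV) (\<lambda>(r, u). G r u)"
    and v: "\<And>t. t \<in> {a..b} \<Longrightarrow> (v has_real_derivative \<psi> (w t / t ^ (CARD('n) - 1))) (at t within {a..b})"
    and w: "\<And>t. t \<in> {a..b} \<Longrightarrow> (w has_real_derivative t ^ (CARD('n) - 1) * (s - G t (v t))) (at t within {a..b})"
    and bc: "w a = 0" "w b = 0"
  shows "radial_solution A G a b s (\<lambda>x::real^'n. v (norm x))"
proof -
  define z where "z t = w t / t ^ (CARD('n) - 1)" for t
  define Du :: "real^'n \<Rightarrow> real^'n" where "Du x = (\<psi> (z (norm x)) / norm x) *\<^sub>R x" for x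
  have vc: "continuous_on {a..b} v" and wc: "continuous_on {a..b} w"
    using DERIV_continuous_on[OF v] DERIV_continuous_on[OF w] by auto
  have zc: "continuous_on {a..b} (\<lambda>t. \<psi> (z t))"
    unfolding z_def using a
    by (intro continuous_on_compose2[OF homeomorphism_cont2[OF h]] continuous_intros wc) auto
  have Gc: "continuous_on {a..b} (\<lambda>t. (\<lambda>(r, u). G r u) (t, v t))"
    using vc by (intro continuous_on_compose2[OF G]) (auto intro!: continuous_intros)
  have flux: "phiN A (Du x) = (w (norm x) / norm x ^ CARD('n)) *\<^sub>R x" if x: "x \<in> annulus a b" for x
  proof -
    have "x \<noteq> 0" using x a by (auto simp: annulus_def)
    then have "phiN A (Du x) = (z (norm x) / norm x) *\<^sub>R x"
      unfolding Du_def using homeomorphism_apply2[OF h] by (simp add: phiN_scaleR)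
    also have "z (norm x) / norm x = w (norm x) / norm x ^ CARD('n)"
      by (cases "CARD('n)") (simp_all add: z_def)
    finally show ?thesis .
  qed
  have w_at: "(w has_real_derivative t ^ (CARD('n) - 1) * (s - G t (v t))) (at t)" if "t \<in> {a<..<b}" for t
    using that by (intro has_real_derivative_Icc_at[OF w]) auto
  have \<psi>0: "\<psi> 0 = 0" using homeomorphism_apply1[OF h, of 0] by (simp add: phi1_def)
  have "is_solution A G a b s (\<lambda>x::real^'n. v (norm x))"
    unfolding is_solution_def
  proof (intro exI[of _ Du] conjI ballI allI impI)
    show "continuous_on (closed_annulus a b) Du"
      unfolding Du_def using C1_radial(1)[OF a(1) v[folded z_def] zc] .
    show "((\<lambda>x. v (norm x)) has_derivative (\<lambda>h. Du x \<bullet> h)) (at x within closed_annulus a b)"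
      if "x \<in> closed_annulus a b" for x
      unfolding Du_def using C1_radial(2)[OF a(1) v[folded z_def] zc that] .
    show "C1_field_on (annulus a b) (\<lambda>x. phiN A (Du x))"
    proof (rule C1_field_on_radial_flux[OF a(1) w_at _ flux])
      show "continuous_on {a<..<b} (\<lambda>t. t ^ (CARD('n) - 1) * (s - G t (v t)))"
        using continuous_on_subset[OF Gc greaterThanLessThan_subseteq_atLeastAtMost_iff[THEN iffD2]] a
        by (auto intro!: continuous_intros)
    qed
    show "divergence (\<lambda>y. phiN A (Du y)) x + G (norm x) (v (norm x)) = s" if x: "x \<in> annulus a b" for x
    proof -
      have "x \<noteq> 0" "norm x \<in> {a<..<b}" using x a by (auto simp: annulus_def)
      then show ?thesis
        using divergence_radial_flux[OF w_at _ open_annulus x flux] by simp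
    qed
    show "Du x \<bullet> outer_normal b x = 0" if "norm x = a \<or> norm x = b" for x
      using that bc \<psi>0 by (auto simp: Du_def z_def)
  qed
  then show ?thesis by (auto simp: radial_solution_def radial_on_def)
qed

text \<open>The solution is restricted to a ray. Once the gradient is known to be radial, the flux
  field has the form treated above, so the equation determines the derivative of \<open>w\<close>
  inside the interval; continuity up to the boundary extends this to the endpoints.\<close>

lemma ode_of_radial_solution:
  fixes u :: "real^'n \<Rightarrow> real"
  assumes a: "0 < a" "a < b" and h: "homeomorphism UNIV UNIV (phi1 A) \<psi>"
    and G: "continuous_on ({a..b} \<times> UNIV) (\<lambda>(r, u). G r u)"
    and u: "radial_solution A G a b s u"
  obtains v w where
    "\<And>t. t \<in> {a..b} \<Longrightarrow> (v has_real_derivative \<psi> (w t / t ^ (CARD('n) - 1))) (at t within {a..b})"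
    "\<And>t. t \<in> {a..b} \<Longrightarrow> (w has_real_derivative t ^ (CARD('n) - 1) * (s - G t (v t))) (at t within {a..b})"
    "w a = 0" "w b = 0"
proof -
  obtain V where V: "\<And>x. x \<in> closed_annulus a b \<Longrightarrow> u x = V (norm x)"
    using u by (auto simp: radial_solution_def radial_on_def)
  obtain Du where Duc: "continuous_on (closed_annulus a b) Du"
    and Du: "\<And>x. x \<in> closed_annulus a b \<Longrightarrow> (u has_derivative (\<lambda>h. Du x \<bullet> h)) (at x within closed_annulus a b)"
    and C1: "C1_field_on (annulus a b) (\<lambda>x. phiN A (Du x))"
    and pde: "\<And>x. x \<in> annulus a b \<Longrightarrow> divergence (\<lambda>y. phiN A (Du y)) x + G (norm x) (u x) = s"
    and bc: "\<And>x. norm x = a \<or> norm x = b \<Longrightarrow> Du x \<bullet> outer_normal b x = 0"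
    using u by (auto simp: radial_solution_def is_solution_def)
  \<comment> \<open>Any unit vector serves; \<open>undefined\<close> merely picks some coordinate
    direction.\<close>
  define e :: "real^'n" where "e = axis undefined 1"
  have e: "norm e = 1" "e \<bullet> e = 1" by (simp_all add: e_def inner_axis_axis)
  define v where "v t = u (t *\<^sub>R e)" for t
  define p where "p t = Du (t *\<^sub>R e) \<bullet> e" for t
  define w where "w t = t ^ (CARD('n) - 1) * phi1 A (p t)" for t
  have e_in: "t *\<^sub>R e \<in> closed_annulus a b" if "t \<in> {a..b}" for t
    using that a e by (simp add: closed_annulus_def)
  have uv: "u x = v (norm x)" if "x \<in> closed_annulus a b" for x
  proof -
    have "norm x \<in> {a..b}" using that by (simp add: closed_annulus_def)
    then show ?thesis using V[OF that] V[OF e_in[of "norm x"]] e by (simp add: v_def)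
  qed
  have dv: "(v has_real_derivative p t) (at t within {a..b})" if t: "t \<in> {a..b}" for t
  proof -
    have "((\<lambda>t. t *\<^sub>R e) has_derivative (\<lambda>h. h *\<^sub>R e)) (at t within {a..b})"
      by (auto intro!: derivative_eq_intros)
    moreover have "(u has_derivative (\<lambda>h. Du (t *\<^sub>R e) \<bullet> h)) (at (t *\<^sub>R e) within (\<lambda>t. t *\<^sub>R e) ` {a..b})"
      using e_in by (intro has_derivative_subset[OF Du[OF e_in[OF t]]]) auto
    ultimately have "((\<lambda>t. u (t *\<^sub>R e)) has_derivative (\<lambda>h. Du (t *\<^sub>R e) \<bullet> (h *\<^sub>R e))) (at t within {a..b})"
      by (rule has_derivative_in_compose)
    moreover have "(\<lambda>h. Du (t *\<^sub>R e) \<bullet> (h *\<^sub>R e)) = (*) (p t)"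
      by (simp add: p_def fun_eq_iff)
    ultimately show ?thesis by (simp add: has_field_derivative_def v_def[abs_def])
  qed
  have vc: "continuous_on {a..b} v" using dv by (rule DERIV_continuous_on)
  have pc: "continuous_on {a..b} p"
    unfolding p_def using e_in by (intro continuous_intros continuous_on_compose2[OF Duc]) auto
  have wc: "continuous_on {a..b} w"
    unfolding w_def by (intro continuous_intros continuous_on_compose2[OF homeomorphism_cont1[OF h] pc]) auto
  have p_eq: "\<psi> (w t / t ^ (CARD('n) - 1)) = p t" if "t \<in> {a..b}" for t
    using that a homeomorphism_apply1[OF h, of "p t"] by (simp add: w_def)
  \<comment> \<open>Near \<open>x\<close> the solution coincides with \<open>v\<close> composed with
    the norm, and at an interior point the derivative is unique.\<close>
  have Du_radial: "Du x = (p (norm x) / norm x) *\<^sub>R x" if x: "x \<in> annulus a b" for x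
  proof -
    have x0: "x \<noteq> 0" and r: "a < norm x" "norm x < b" using x a by (auto simp: annulus_def)
    have at: "at x within annulus a b = at x"
      using open_annulus x by (rule at_within_open[rotated])
    have "x \<in> closed_annulus a b" using x annulus_subset_closed by blast
    from has_derivative_subset[OF Du[OF this] annulus_subset_closed]
    have "(u has_derivative (\<lambda>h. Du x \<bullet> h)) (at x)" by (simp only: at)
    moreover have "((\<lambda>y. v (norm y)) has_derivative (\<lambda>h. ((p (norm x) / norm x) *\<^sub>R x) \<bullet> h)) (at x)"
      using has_derivative_radial[OF has_real_derivative_Icc_at[OF dv r] x0, of UNIV] r by simp
    then have "(u has_derivative (\<lambda>h. ((p (norm x) / norm x) *\<^sub>R x) \<bullet> h)) (at x)"
    proof (rule has_derivative_transform_within_open[OF _ open_annulus x])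
      show "v (norm y) = u y" if "y \<in> annulus a b" for y
        using uv that annulus_subset_closed by fastforce
    qed
    ultimately have "(\<lambda>h. Du x \<bullet> h) = (\<lambda>h. ((p (norm x) / norm x) *\<^sub>R x) \<bullet> h)"
      by (rule has_derivative_unique)
    then have "\<forall>h. Du x \<bullet> h = ((p (norm x) / norm x) *\<^sub>R x) \<bullet> h" by (rule fun_cong[THEN allI])
    then show ?thesis by (simp only: vector_eq_rdot)
  qed
  have flux: "phiN A (Du x) = (w (norm x) / norm x ^ CARD('n)) *\<^sub>R x" if x: "x \<in> annulus a b" for x
  proof -
    have x0: "x \<noteq> 0" using x a by (auto simp: annulus_def)
    then have "phiN A (Du x) = (phi1 A (p (norm x)) / norm x) *\<^sub>R x"
      using Du_radial[OF x] by (simp add: phiN_scaleR)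
    also have "phi1 A (p (norm x)) / norm x = w (norm x) / norm x ^ CARD('n)"
      using x0 by (cases "CARD('n)") (simp_all add: w_def)
    finally show ?thesis .
  qed
  \<comment> \<open>Classical regularity of the flux field first yields some derivative
    \<open>D\<close> along the ray; the divergence formula and the equation then identify its
    value.\<close>
  have dw: "(w has_real_derivative t ^ (CARD('n) - 1) * (s - G t (v t))) (at t)" if t: "t \<in> {a<..<b}" for t
  proof -
    have te: "t *\<^sub>R e \<in> annulus a b" "norm (t *\<^sub>R e) = t" "t \<noteq> 0" "t *\<^sub>R e \<noteq> 0"
      using t a e by (auto simp: annulus_def)
    have "(\<lambda>x. phiN A (Du x)) differentiable at (t *\<^sub>R e)"
      using C1 te by (simp add: C1_field_on_def)
    then obtain F' where "((\<lambda>x. phiN A (Du x)) has_derivative F') (at (t *\<^sub>R e))"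
      by (auto simp: differentiable_def)
    moreover have "((\<lambda>t. t *\<^sub>R e) has_derivative (\<lambda>h. h *\<^sub>R e)) (at t)"
      by (auto intro!: derivative_eq_intros)
    ultimately have "((\<lambda>t. phiN A (Du (t *\<^sub>R e))) has_derivative (\<lambda>h. F' (h *\<^sub>R e))) (at t)"
      by (rule has_derivative_compose[rotated])
    then have "(\<lambda>t. phiN A (Du (t *\<^sub>R e)) \<bullet> e) differentiable at t"
      unfolding differentiable_def by (intro exI) (rule has_derivative_inner_left)
    then have "(\<lambda>t. t ^ (CARD('n) - 1) * (phiN A (Du (t *\<^sub>R e)) \<bullet> e)) differentiable at t"
      by (intro derivative_intros)
    then obtain D where "((\<lambda>t. t ^ (CARD('n) - 1) * (phiN A (Du (t *\<^sub>R e)) \<bullet> e)) has_real_derivative D) (at t)"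
      by (auto simp: real_differentiable_def)
    moreover have "r ^ (CARD('n) - 1) * (phiN A (Du (r *\<^sub>R e)) \<bullet> e) = w r" if r: "r \<in> {a<..<b}" for r
    proof -
      have "r *\<^sub>R e \<in> annulus a b" "norm (r *\<^sub>R e) = r" "r \<noteq> 0" using r a e by (auto simp: annulus_def)
      then show ?thesis using flux[of "r *\<^sub>R e"] e by (cases "CARD('n)") (auto simp: field_simps)
    qed
    ultimately have D: "(w has_real_derivative D) (at t)"
      using has_field_derivative_transform_within_open[OF _ open_greaterThanLessThan t] by blast
    have "divergence (\<lambda>x. phiN A (Du x)) (t *\<^sub>R e) = D / norm (t *\<^sub>R e) ^ (CARD('n) - 1)"
      by (rule divergence_radial_flux[OF _ te(4) open_annulus te(1) flux]) (use D te in auto)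
    then have "D / t ^ (CARD('n) - 1) = s - G t (v t)"
      using pde[OF te(1)] te by (simp add: v_def)
    then have "D = t ^ (CARD('n) - 1) * (s - G t (v t))" using te by (simp add: field_simps)
    then show ?thesis using D by simp
  qed
  have "continuous_on {a..b} (\<lambda>t. (\<lambda>(r, u). G r u) (t, v t))"
    using vc by (intro continuous_on_compose2[OF G]) (auto intro!: continuous_intros)
  then have fc: "continuous_on {a..b} (\<lambda>t. t ^ (CARD('n) - 1) * (s - G t (v t)))"
    by (auto intro!: continuous_intros)
  \<comment> \<open>The equation for \<open>w\<close> is known only in the open interval; this
    integral form yields one-sided derivatives at both ends.\<close>
  have w_int: "w t = w a + integral {a..t} (\<lambda>t. t ^ (CARD('n) - 1) * (s - G t (v t)))" if t: "t \<in> {a..b}" for t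
  proof -
    have "((\<lambda>t. t ^ (CARD('n) - 1) * (s - G t (v t))) has_integral (w t - w a)) {a..t}"
    proof (rule fundamental_theorem_of_calculus_interior)
      show "a \<le> t" "continuous_on {a..t} w"
        using t by (auto intro: continuous_on_subset[OF wc])
      show "(w has_vector_derivative x ^ (CARD('n) - 1) * (s - G x (v x))) (at x)" if "x \<in> {a<..<t}" for x
        using dw[of x] that t by (simp add: has_real_derivative_iff_has_vector_derivative)
    qed
    then show ?thesis by (simp add: integral_unique)
  qed
  have dw': "(w has_real_derivative t ^ (CARD('n) - 1) * (s - G t (v t))) (at t within {a..b})" if t: "t \<in> {a..b}" for t
  proof -
    have "((\<lambda>t. w a + integral {a..t} (\<lambda>t. t ^ (CARD('n) - 1) * (s - G t (v t)))) has_real_derivative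
        t ^ (CARD('n) - 1) * (s - G t (v t))) (at t within {a..b})"
      using integral_has_real_derivative[OF fc t] by (auto intro!: derivative_eq_intros)
    then show ?thesis
      unfolding has_real_derivative_iff_has_vector_derivative
      using t by (rule has_vector_derivative_transform[rotated 2]) (rule w_int)
  qed
  have "norm (a *\<^sub>R e) = a" "norm (b *\<^sub>R e) = b" using a e by auto
  then have "p a = 0" "p b = 0"
    using bc[of "a *\<^sub>R e"] bc[of "b *\<^sub>R e"] a by (auto simp: p_def outer_normal_def)
  then have "w a = 0" "w b = 0" by (simp_all add: w_def phi1_def)
  then show ?thesis using that[of v w] dv dw' p_eq by auto
qed

text \<open>The predicate \<open>Q\<close> covers both coercivity conditions at once. The weight has
  positive integral, so the strict inequality between averages can be multiplied out.\<close>

lemma average_condition_radial: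
  fixes G :: "real \<Rightarrow> real \<Rightarrow> real"
  assumes a: "0 < a" "a < b" and G: "continuous_on ({a..b} \<times> UNIV) (\<lambda>(r, u). G r u)"
    and avg: "\<And>u :: real^'n \<Rightarrow> real. \<lbrakk>continuous_on (closed_annulus a b) u; C1_on (annulus a b) u;
      radial_on (closed_annulus a b) u; \<And>x. x \<in> annulus a b \<Longrightarrow> Q (u x)\<rbrakk> \<Longrightarrow> avgG G a b u > \<sigma>"
    and v': "continuous_on {a..b} v'"
    and v: "\<And>t. t \<in> {a..b} \<Longrightarrow> (v has_real_derivative v' t) (at t within {a..b})"
    and Q: "\<And>t. t \<in> {a..b} \<Longrightarrow> Q (v t)"
  shows "integral {a..b} (\<lambda>t. t ^ (CARD('n) - 1) * (\<sigma> - G t (v t))) < 0"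
proof -
  have vc: "continuous_on {a..b} v" using v by (rule DERIV_continuous_on)
  have "continuous_on {a..b} (\<lambda>t. (\<lambda>(r, u). G r u) (t, v t))"
    using vc by (intro continuous_on_compose2[OF G]) (auto intro!: continuous_intros)
  then have Gc: "continuous_on {a..b} (\<lambda>t. G t (v t))" by simp
  note C1 = C1_radial[OF a(1) v v', where 'n = 'n]
  have "C1_on (annulus a b) (\<lambda>x::real^'n. v (norm x))"
    unfolding C1_on_def
  proof (intro exI conjI ballI)
    show "continuous_on (annulus a b) (\<lambda>x::real^'n. (v' (norm x) / norm x) *\<^sub>R x)"
      using C1(1) annulus_subset_closed by (rule continuous_on_subset)
    show "((\<lambda>x. v (norm x)) has_derivative (\<lambda>h. ((v' (norm x) / norm x) *\<^sub>R x) \<bullet> h)) (at x within annulus a b)"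
      if "x \<in> annulus a b" for x :: "real^'n"
      using that annulus_subset_closed by (intro has_derivative_subset[OF C1(2)]) auto
  qed
  then have "avgG G a b (\<lambda>x::real^'n. v (norm x)) > \<sigma>"
    using Q by (intro avg continuous_on_radial[OF vc order_refl]) (auto simp: radial_on_def annulus_def)
  then have gt: "\<sigma> < integral {a..b} (\<lambda>t. t ^ (CARD('n) - 1) * G t (v t)) / integral {a..b} (\<lambda>t. t ^ (CARD('n) - 1))"
    using avgG_radial[of a b G v, where 'n = 'n] a Gc by simp
  have int: "(\<lambda>t. \<sigma> * t ^ (CARD('n) - 1)) integrable_on {a..b}" "(\<lambda>t. t ^ (CARD('n) - 1) * G t (v t)) integrable_on {a..b}"
    by (intro integrable_continuous_real continuous_intros Gc)+
  have "0 \<le> integral {a..b} (\<lambda>t. t ^ (CARD('n) - 1))"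
    using a by (intro integral_nonneg integrable_continuous_real continuous_intros) auto
  moreover have "integral {a..b} (\<lambda>t. t ^ (CARD('n) - 1)) \<noteq> 0"
  proof
    assume "integral {a..b} (\<lambda>t. t ^ (CARD('n) - 1)) = 0"
    then have "\<forall>t\<in>{a..b}. t ^ (CARD('n) - 1) = 0"
      using a by (subst (asm) integral_eq_0_iff) (auto intro!: continuous_intros)
    then show False using a by auto
  qed
  ultimately have "\<sigma> * integral {a..b} (\<lambda>t. t ^ (CARD('n) - 1)) < integral {a..b} (\<lambda>t. t ^ (CARD('n) - 1) * G t (v t))"
    using gt by (simp add: pos_less_divide_eq)
  moreover have "(\<lambda>t. t ^ (CARD('n) - 1) * (\<sigma> - G t (v t))) = (\<lambda>t. \<sigma> * t ^ (CARD('n) - 1) - t ^ (CARD('n) - 1) * G t (v t))"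
    by (auto simp: algebra_simps)
  ultimately show ?thesis
    using integral_diff[OF int] by simp
qed

theorem theorem4p5:
  fixes A :: "real \<Rightarrow> real" and G :: "real \<Rightarrow> real \<Rightarrow> real" and Rint Rext :: real
  assumes N2: "CARD('n) \<ge> 2"
    and radii: "0 < Rint" "Rint < Rext"
    and A_cont: "continuous_on {0<..} A" and A_pos: "\<forall>t>0. A t > 0"
    and phi_homeo: "\<exists>g. homeomorphism UNIV UNIV (phi1 A) g"
    and G_cont: "continuous_on ({Rint..Rext} \<times> UNIV) (\<lambda>(r, u). G r u)"
    and G1: "\<exists>C0>0. \<forall>x\<in>(annulus Rint Rext :: (real^'n) set). \<forall>u. G (norm x) u \<ge> - C0"
    and G2: "\<exists>u0 g0. \<forall>x\<in>(annulus Rint Rext :: (real^'n) set). G (norm x) u0 \<le> g0"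
    and G3: "\<forall>\<sigma>. \<exists>d>0. \<forall>u :: real^'n \<Rightarrow> real.
               continuous_on (closed_annulus Rint Rext) u \<and> C1_on (annulus Rint Rext) u \<and>
               radial_on (closed_annulus Rint Rext) u \<and> (\<forall>x\<in>annulus Rint Rext. u x \<le> - d)
               \<longrightarrow> avgG G Rint Rext u > \<sigma>"
    and G4: "\<forall>\<sigma>. \<exists>d>0. \<forall>u :: real^'n \<Rightarrow> real.
               continuous_on (closed_annulus Rint Rext) u \<and> C1_on (annulus Rint Rext) u \<and>
               radial_on (closed_annulus Rint Rext) u \<and> (\<forall>x\<in>annulus Rint Rext. u x \<ge> d)
               \<longrightarrow> avgG G Rint Rext u > \<sigma>"
  shows "\<exists>s0. (\<forall>s<s0. \<not> (\<exists>u :: real^'n \<Rightarrow> real. radial_solution A G Rint Rext s u))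
            \<and> (\<exists>u :: real^'n \<Rightarrow> real. radial_solution A G Rint Rext s0 u)
            \<and> (\<forall>s>s0. \<exists>u1 u2 :: real^'n \<Rightarrow> real. radial_solution A G Rint Rext s u1 \<and>
                   radial_solution A G Rint Rext s u2 \<and>
                   (\<exists>x\<in>closed_annulus Rint Rext. u1 x \<noteq> u2 x))"
proof -
  obtain \<psi> where h: "homeomorphism UNIV UNIV (phi1 A) \<psi>" using phi_homeo by blast
  obtain C0 where C0: "C0 > 0" "\<And>(x::real^'n) u. x \<in> annulus Rint Rext \<Longrightarrow> - C0 \<le> G (norm x) u" using G1 by blast
  obtain u0 g0 where g0: "\<And>x::real^'n. x \<in> annulus Rint Rext \<Longrightarrow> G (norm x) u0 \<le> g0" using G2 by blast
  define e :: "real^'n" where "e = axis undefined 1"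
  have e: "norm e = 1" by (simp add: e_def)
  have e_in: "t *\<^sub>R e \<in> annulus Rint Rext" "norm (t *\<^sub>R e) = t" if "t \<in> {Rint<..<Rext}" for t
    using that radii e by (auto simp: annulus_def)
  have Gc: "continuous_on {Rint..Rext} (\<lambda>t. G t u)" for u
  proof -
    have "continuous_on {Rint..Rext} (\<lambda>t. (\<lambda>(r, u). G r u) (t, u))"
      by (intro continuous_on_compose2[OF G_cont]) (auto intro!: continuous_intros)
    then show ?thesis by simp
  qed
  have cl: "closure {Rint<..<Rext} = {Rint..Rext}" using radii by simp
  \<comment> \<open>The hypotheses concern the open annulus; points on a ray transfer them to radii,
    and continuity reaches the two boundary radii.\<close>
  have lower: "- C0 \<le> G t u" if t: "t \<in> {Rint..Rext}" for t u
  proof (rule continuous_ge_on_closure[of "{Rint<..<Rext}" "\<lambda>t. G t u"])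
    show "- C0 \<le> G t u" if "t \<in> {Rint<..<Rext}" for t
      using C0(2)[OF e_in(1)[OF that], of u] by (simp only: e_in(2)[OF that])
  qed (simp_all only: cl Gc t)
  have upper: "G t u0 \<le> g0" if t: "t \<in> {Rint..Rext}" for t
  proof (rule continuous_le_on_closure[of "{Rint<..<Rext}" "\<lambda>t. G t u0"])
    show "G t u0 \<le> g0" if "t \<in> {Rint<..<Rext}" for t
      using g0[OF e_in(1)[OF that]] by (simp only: e_in(2)[OF that])
  qed (simp_all only: cl Gc t)
  have mono: "strict_mono \<psi>"
  proof (rule strict_monoI)
    fix x y :: real assume "x < y"
    then have "phi1 A (\<psi> x) < phi1 A (\<psi> y)" using homeomorphism_apply2[OF h] by simp
    then show "\<psi> x < \<psi> y" using strict_mono_phi1[OF A_pos h] by (simp add: strict_mono_less)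
  qed
  interpret neumann_bvp Rint Rext "\<lambda>t. t ^ (CARD('n) - 1)" \<psi> G C0
  proof
    show "continuous_on {Rint..Rext} (\<lambda>t. t ^ (CARD('n) - 1))"
      by (intro continuous_intros)
    show "continuous_on UNIV \<psi>" using h by (rule homeomorphism_cont2)
    show "\<psi> 0 = 0" using homeomorphism_apply1[OF h, of 0] by (simp add: phi1_def)
    show "\<exists>u0 g0. \<forall>t\<in>{Rint..Rext}. G t u0 \<le> g0" using upper by blast
    show "\<exists>d. \<forall>v v'. continuous_on {Rint..Rext} v' \<longrightarrow>
        (\<forall>t\<in>{Rint..Rext}. (v has_real_derivative v' t) (at t within {Rint..Rext})) \<longrightarrow> (\<forall>t\<in>{Rint..Rext}. v t \<le> - d) \<longrightarrow>
        integral {Rint..Rext} (\<lambda>t. t ^ (CARD('n) - 1) * (\<sigma> - G t (v t))) < 0" for \<sigma>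
    proof -
      from G3 obtain d where d: "\<forall>u :: real^'n \<Rightarrow> real.
          continuous_on (closed_annulus Rint Rext) u \<and> C1_on (annulus Rint Rext) u \<and>
          radial_on (closed_annulus Rint Rext) u \<and> (\<forall>x\<in>annulus Rint Rext. u x \<le> - d)
          \<longrightarrow> avgG G Rint Rext u > \<sigma>"
        by blast
      show ?thesis
      proof (intro exI[of _ d] allI impI)
        fix v v' assume v': "continuous_on {Rint..Rext} v'"
          and v: "\<forall>t\<in>{Rint..Rext}. (v has_real_derivative v' t) (at t within {Rint..Rext})"
          and le: "\<forall>t\<in>{Rint..Rext}. v t \<le> - d"
        show "integral {Rint..Rext} (\<lambda>t. t ^ (CARD('n) - 1) * (\<sigma> - G t (v t))) < 0"
        proof (rule average_condition_radial[where Q = "\<lambda>y. y \<le> - d", OF radii G_cont _ v' bspec[OF v] bspec[OF le]])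
          fix u :: "real^'n \<Rightarrow> real"
          assume "continuous_on (closed_annulus Rint Rext) u" "C1_on (annulus Rint Rext) u"
            "radial_on (closed_annulus Rint Rext) u" "\<And>x. x \<in> annulus Rint Rext \<Longrightarrow> u x \<le> - d"
          then show "\<sigma> < avgG G Rint Rext u" using d by blast
        qed
      qed
    qed
    show "\<exists>d. \<forall>v v'. continuous_on {Rint..Rext} v' \<longrightarrow>
        (\<forall>t\<in>{Rint..Rext}. (v has_real_derivative v' t) (at t within {Rint..Rext})) \<longrightarrow> (\<forall>t\<in>{Rint..Rext}. v t \<ge> d) \<longrightarrow>
        integral {Rint..Rext} (\<lambda>t. t ^ (CARD('n) - 1) * (\<sigma> - G t (v t))) < 0" for \<sigma>
    proof -
      from G4 obtain d where d: "\<forall>u :: real^'n \<Rightarrow> real.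
          continuous_on (closed_annulus Rint Rext) u \<and> C1_on (annulus Rint Rext) u \<and>
          radial_on (closed_annulus Rint Rext) u \<and> (\<forall>x\<in>annulus Rint Rext. u x \<ge> d)
          \<longrightarrow> avgG G Rint Rext u > \<sigma>"
        by blast
      show ?thesis
      proof (intro exI[of _ d] allI impI)
        fix v v' assume v': "continuous_on {Rint..Rext} v'"
          and v: "\<forall>t\<in>{Rint..Rext}. (v has_real_derivative v' t) (at t within {Rint..Rext})"
          and le: "\<forall>t\<in>{Rint..Rext}. v t \<ge> d"
        show "integral {Rint..Rext} (\<lambda>t. t ^ (CARD('n) - 1) * (\<sigma> - G t (v t))) < 0"
        proof (rule average_condition_radial[where Q = "\<lambda>y. y \<ge> d", OF radii G_cont _ v' bspec[OF v] bspec[OF le]])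
          fix u :: "real^'n \<Rightarrow> real"
          assume "continuous_on (closed_annulus Rint Rext) u" "C1_on (annulus Rint Rext) u"
            "radial_on (closed_annulus Rint Rext) u" "\<And>x. x \<in> annulus Rint Rext \<Longrightarrow> u x \<ge> d"
          then show "\<sigma> < avgG G Rint Rext u" using d by blast
        qed
      qed
    qed
  qed (use radii C0(1) in \<open>simp_all add: mono G_cont lower\<close>)
  have to_pde: "radial_solution A G Rint Rext s (\<lambda>x::real^'n. v (norm x))" if "sol s v w" for s v w
    using that unfolding sol_def
    by (intro radial_solution_of_ode[OF radii h G_cont, where v = v and w = w]) auto
  have to_ode: "\<exists>v w. sol s v w" if u: "radial_solution A G Rint Rext s (u :: real^'n \<Rightarrow> real)" for s u
  proof -
    obtain v w where "\<And>t. t \<in> {Rint..Rext} \<Longrightarrow> (v has_real_derivative \<psi> (w t / t ^ (CARD('n) - 1))) (at t within {Rint..Rext})"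
      "\<And>t. t \<in> {Rint..Rext} \<Longrightarrow> (w has_real_derivative t ^ (CARD('n) - 1) * (s - G t (v t))) (at t within {Rint..Rext})"
      "w Rint = 0" "w Rext = 0"
      using ode_of_radial_solution[OF radii h G_cont u] by blast
    then have "sol s v w" unfolding sol_def by blast
    then show ?thesis by blast
  qed
  obtain s0 where s0: "\<And>s v w. s < s0 \<Longrightarrow> \<not> sol s v w" "\<exists>v w. sol s0 v w"
    "\<And>s. s0 < s \<Longrightarrow> \<exists>v1 w1 v2 w2. sol s v1 w1 \<and> sol s v2 w2 \<and> (\<exists>t\<in>{Rint..Rext}. v1 t \<noteq> v2 t)"
    using threshold by blast
  show ?thesis
  proof (intro exI[of _ s0] conjI allI impI)
    show "\<not> (\<exists>u :: real^'n \<Rightarrow> real. radial_solution A G Rint Rext s u)" if "s < s0" for s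
      using to_ode s0(1)[OF that] by blast
    show "\<exists>u :: real^'n \<Rightarrow> real. radial_solution A G Rint Rext s0 u"
      using to_pde s0(2) by blast
    fix s assume "s0 < s"
    then obtain v1 w1 v2 w2 t where sol: "sol s v1 w1" "sol s v2 w2" and t: "t \<in> {Rint..Rext}" "v1 t \<noteq> v2 t"
      using s0(3) by blast
    \<comment> \<open>The point on the ray at radius \<open>t\<close> separates the two radial
      functions.\<close>
    have "t *\<^sub>R e \<in> closed_annulus Rint Rext" "norm (t *\<^sub>R e) = t"
      using t radii e by (auto simp: closed_annulus_def)
    then have "\<exists>x\<in>closed_annulus Rint Rext. v1 (norm (x::real^'n)) \<noteq> v2 (norm x)"
      using t by metis
    then show "\<exists>u1 u2 :: real^'n \<Rightarrow> real. radial_solution A G Rint Rext s u1 \<and>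
        radial_solution A G Rint Rext s u2 \<and> (\<exists>x\<in>closed_annulus Rint Rext. u1 x \<noteq> u2 x)"
      using to_pde[OF sol(1)] to_pde[OF sol(2)] by blast
  qed
qed

end
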